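(* If the Minimum Circuit Size Problem on inputs of length $N$ can be computed by some function in ${\sf FORMULA}[s]\circ{\sf XOR}$ (on $N$ input bits), then $s=\tilde\Omega(N^2)$, i.e. $s\ge N^2/\mathrm{polylog}(N)$.
   Context: A de Morgan formula is a rooted tree whose internal gates are AND, OR (fan-in 2) and NOT (fan-in 1) and whose leaves are labelled by inputs; its size is the number of leaves. ${\sf FORMULA}[s]\circ{\sf XOR}$ is the class of functions $F(g_1(x),\dots,g_s(x))$ where $F$ is a de Morgan formula of size at most $s$ and each $g_i$ is a parity function $x\mapsto\bigoplus_{i\in S}x_i$ or its negation. Minimum Circuit Size Problem (MCSP): the input (of total length $N$, in a fixed encoding) consists of the truth table of a function $f\colon\{0,1\}^{\log n}\to\{0,1\}$ (an $n$-bit string) and a string $1^\ell$; the answer is $1$ iff $f$ has Boolean circuit complexity at most $\ell$. *)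

theory Defs
  imports Main "HOL-Library.Log_Nat" Complex_Main
begin

text \<open>A circuit on m inputs is a list of gates plus an output wire.
  Wires 0..m-1 are the inputs; wire m+j is the output of gate j.
  Gate j may only read wires with index < m+j. The size of a circuit is
  its number of gates.\<close>

datatype gate = GAnd nat nat | GOr nat nat | GNot nat

fun gate_val :: "bool list \<Rightarrow> gate \<Rightarrow> bool" where
  "gate_val vs (GAnd u v) = (vs ! u \<and> vs ! v)"
| "gate_val vs (GOr u v) = (vs ! u \<or> vs ! v)"
| "gate_val vs (GNot u) = (\<not> vs ! u)"

fun gate_inputs :: "gate \<Rightarrow> nat set" where
  "gate_inputs (GAnd u v) = {u, v}"
| "gate_inputs (GOr u v) = {u, v}"
| "gate_inputs (GNot u) = {u}"

definition wire_vals :: "nat \<Rightarrow> gate list \<Rightarrow> (nat \<Rightarrow> bool) \<Rightarrow> bool list" where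
  "wire_vals m gs a = foldl (\<lambda>vs g. vs @ [gate_val vs g]) (map a [0..<m]) gs"

definition wf_circuit :: "nat \<Rightarrow> gate list \<Rightarrow> nat \<Rightarrow> bool" where
  "wf_circuit m gs out \<longleftrightarrow>
     (\<forall>j < length gs. \<forall>w \<in> gate_inputs (gs ! j). w < m + j) \<and> out < m + length gs"

text \<open>Truth-table convention: the truth table tt of f : {0,1}^m \<rightarrow> {0,1}
  has length 2^m and entry i is f at the input whose j-th bit is bit j of i.\<close>

definition circuit_computes :: "nat \<Rightarrow> gate list \<Rightarrow> nat \<Rightarrow> bool list \<Rightarrow> bool" where
  "circuit_computes m gs out tt \<longleftrightarrow>
     (\<forall>i < 2 ^ m. wire_vals m gs (\<lambda>j. odd (i div 2 ^ j)) ! out = tt ! i)"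

definition circuit_size_le :: "nat \<Rightarrow> bool list \<Rightarrow> nat \<Rightarrow> bool" where
  "circuit_size_le m tt l \<longleftrightarrow>
     (\<exists>gs out. wf_circuit m gs out \<and> length gs \<le> l \<and> circuit_computes m gs out tt)"

definition mcsp :: "nat \<Rightarrow> bool list \<Rightarrow> bool" where
  "mcsp m x \<longleftrightarrow> length x = 2 * 2 ^ m \<and>
     (\<exists>l \<le> 2 ^ m. drop (2 ^ m) x = replicate l True @ replicate (2 ^ m - l) False
                 \<and> circuit_size_le m (take (2 ^ m) x) l)"

datatype 'a dmformula = Leaf 'a | FAnd "'a dmformula" "'a dmformula"
  | FOr "'a dmformula" "'a dmformula" | FNot "'a dmformula"

fun feval :: "('a \<Rightarrow> bool) \<Rightarrow> 'a dmformula \<Rightarrow> bool" where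
  "feval v (Leaf a) = v a"
| "feval v (FAnd p q) = (feval v p \<and> feval v q)"
| "feval v (FOr p q) = (feval v p \<or> feval v q)"
| "feval v (FNot p) = (\<not> feval v p)"

fun fsize :: "'a dmformula \<Rightarrow> nat" where
  "fsize (Leaf a) = 1"
| "fsize (FAnd p q) = fsize p + fsize q"
| "fsize (FOr p q) = fsize p + fsize q"
| "fsize (FNot p) = fsize p"

fun fleaves :: "'a dmformula \<Rightarrow> 'a set" where
  "fleaves (Leaf a) = {a}"
| "fleaves (FAnd p q) = fleaves p \<union> fleaves q"
| "fleaves (FOr p q) = fleaves p \<union> fleaves q"
| "fleaves (FNot p) = fleaves p"

definition parity_fn :: "nat set \<times> bool \<Rightarrow> bool list \<Rightarrow> bool" where
  "parity_fn g x = (snd g \<noteq> odd (card {i \<in> fst g. x ! i}))"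

definition in_formula_xor :: "nat \<Rightarrow> nat \<Rightarrow> (bool list \<Rightarrow> bool) \<Rightarrow> bool" where
  "in_formula_xor N s h \<longleftrightarrow>
     (\<exists>(F :: nat dmformula) (g :: nat \<Rightarrow> nat set \<times> bool).
        fsize F \<le> s \<and> fleaves F \<subseteq> {..<s} \<and> (\<forall>i < s. fst (g i) \<subseteq> {..<N}) \<and>
        (\<forall>x. length x = N \<longrightarrow> feval (\<lambda>i. parity_fn (g i) x) F = h x))"

end

(*
Suppose a formula F of size s over parities computes MCSP.

(1) Formulas of size s have real approximants of degree O(sqrt s). By induction on F there are
weights alpha_x (on 1-inputs) and beta_y (on 0-inputs), indexed by the leaves, with
|alpha_x|^2 <= 1, |beta_y|^2 <= s, and total mass sum alpha_x(j) beta_y(j) = 1 on the leaves where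
x and y differ. Let M be the reflection fixing all vectors w_x = e_0 + (1/4) sum_j alpha_x(j)
|j, x_j>, and let D_x be the diagonal sign matrix that is +1 on e_0 and on |j, x_j>. On 1-inputs
D_x M fixes w_x, which is close to e_0; on 0-inputs, v_y = e_0 - 4 sum_j beta_y(j) |j, not y_j> is
orthogonal to all w_x, so D_y M v_y = v_y - 2 e_0. Hence the e_0-entry of the average of the first
tau = O(sqrt s) powers of D_x M, a polynomial of degree less than tau in the signs of the leaves,
is at least 3/4 on 1-inputs and, by telescoping, at most 1/4 on 0-inputs.

(2) Only about s^tau parities occur in products of at most tau leaves. Conjunctions of few affine
forms (the Valiant-Vazirani hashes) have odd intersection with any given nonempty set with
noticeable probability, so r = O~(tau) of them suffice to unbias all these parities: the sum mod 2
of a random subset of the r hashes is indistinguishable from a uniform truth table by such products.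
It has circuits of size O~(tau), whereas most truth tables of length 2^m need size about 2^m/m.
So tau = O~(sqrt s) cannot be much smaller than 2^m.
*)

theory Submission
  imports Defs
begin

section \<open>Leaf weights and reflections\<close>

text \<open>A feasible solution of the dual of the general adversary bound, with scalars in place of
  vectors. Leaves are indexed by position because one label may occur at several leaves. The
  lopsided bounds 1 and \<open>s\<close> are what makes the sizes add under OR.\<close>

definition leaf_weights :: "(('a \<Rightarrow> bool) \<Rightarrow> bool) \<Rightarrow> nat \<Rightarrow> 'a set \<Rightarrow> bool" where
  "leaf_weights f s A \<longleftrightarrow> (\<exists>(lab :: nat \<Rightarrow> 'a) (\<alpha> :: ('a \<Rightarrow> bool) \<Rightarrow> nat \<Rightarrow> real) \<beta>.
     (\<forall>j<s. lab j \<in> A) \<and>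
     (\<forall>x. f x \<longrightarrow> (\<Sum>j<s. (\<alpha> x j)\<^sup>2) \<le> 1) \<and>
     (\<forall>y. \<not> f y \<longrightarrow> (\<Sum>j<s. (\<beta> y j)\<^sup>2) \<le> real s) \<and>
     (\<forall>x y. f x \<longrightarrow> \<not> f y \<longrightarrow>
        (\<Sum>j<s. if x (lab j) \<noteq> y (lab j) then \<alpha> x j * \<beta> y j else 0) = 1))"

text \<open>Negation swaps the two weight systems. Dividing one by sqrt s and multiplying the other
  by it restores the bounds 1 and \<open>s\<close> and leaves every product unchanged.\<close>

lemma leaf_weights_not:
  assumes "leaf_weights f s A" "s > 0"
  shows "leaf_weights (\<lambda>x. \<not> f x) s A"
proof -
  obtain lab \<alpha> \<beta> where lab: "\<forall>j<s. lab j \<in> A"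
    and a: "\<And>x. f x \<Longrightarrow> (\<Sum>j<s. (\<alpha> x j)\<^sup>2) \<le> (1::real)"
    and b: "\<And>y. \<not> f y \<Longrightarrow> (\<Sum>j<s. (\<beta> y j)\<^sup>2) \<le> real s"
    and ab: "\<And>x y. f x \<Longrightarrow> \<not> f y \<Longrightarrow>
        (\<Sum>j<s. if x (lab j) \<noteq> y (lab j) then \<alpha> x j * \<beta> y j else 0) = 1"
    using assms(1) unfolding leaf_weights_def by blast
  have "(\<Sum>j<s. (\<beta> x j / sqrt s)\<^sup>2) \<le> 1" if "\<not> f x" for x
    using b[OF that] \<open>s > 0\<close>
    by (simp add: power_divide sum_divide_distrib[symmetric] divide_le_eq)
  moreover have "(\<Sum>j<s. (sqrt s * \<alpha> y j)\<^sup>2) \<le> real s" if "f y" for y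
    using mult_left_mono[OF a[OF that], of "real s"]
    by (simp add: power_mult_distrib sum_distrib_left[symmetric])
  moreover have "(\<Sum>j<s. if x (lab j) \<noteq> y (lab j) then \<beta> x j / sqrt s * (sqrt s * \<alpha> y j) else 0) = 1"
    if "\<not> f x" "f y" for x y
  proof -
    have "(\<Sum>j<s. if x (lab j) \<noteq> y (lab j) then \<beta> x j / sqrt s * (sqrt s * \<alpha> y j) else 0)
        = (\<Sum>j<s. if y (lab j) \<noteq> x (lab j) then \<alpha> y j * \<beta> x j else 0)"
      using \<open>s > 0\<close> by (intro sum.cong) auto
    then show ?thesis using ab[of y x] that by simp
  qed
  ultimately show ?thesis unfolding leaf_weights_def not_not
    by (intro exI[of _ lab] exI[of _ "\<lambda>x j. \<beta> x j / sqrt s"] exI[of _ "\<lambda>y j. sqrt s * \<alpha> y j"]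
        conjI allI impI) (simp_all only: lab)
qed

lemma sum_lessThan_add_split:
  fixes h :: "nat \<Rightarrow> 'b::comm_monoid_add"
  shows "(\<Sum>j<a + b. h j) = (\<Sum>j<a. h j) + (\<Sum>j<b. h (a + j))"
  by (induction b) (auto simp: add.assoc)

text \<open>A 1-input puts all its weight on the leaves of a single true disjunct, so its bound
  stays 1. A 0-input falsifies both disjuncts and uses both weight systems, so its bounds
  \<open>s1\<close> and \<open>s2\<close> add.\<close>

lemma leaf_weights_or:
  assumes "leaf_weights f1 s1 A1" "leaf_weights f2 s2 A2"
  shows "leaf_weights (\<lambda>x. f1 x \<or> f2 x) (s1 + s2) (A1 \<union> A2)"
proof -
  obtain l1 a1 b1 where l1: "\<And>j. j < s1 \<Longrightarrow> l1 j \<in> A1"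
    and a1: "\<And>x. f1 x \<Longrightarrow> (\<Sum>j<s1. (a1 x j)\<^sup>2) \<le> (1::real)"
    and b1: "\<And>y. \<not> f1 y \<Longrightarrow> (\<Sum>j<s1. (b1 y j)\<^sup>2) \<le> real s1"
    and ab1: "\<And>x y. f1 x \<Longrightarrow> \<not> f1 y \<Longrightarrow>
        (\<Sum>j<s1. if x (l1 j) \<noteq> y (l1 j) then a1 x j * b1 y j else 0) = 1"
    using assms(1) unfolding leaf_weights_def by blast
  obtain l2 a2 b2 where l2: "\<And>j. j < s2 \<Longrightarrow> l2 j \<in> A2"
    and a2: "\<And>x. f2 x \<Longrightarrow> (\<Sum>j<s2. (a2 x j)\<^sup>2) \<le> (1::real)"
    and b2: "\<And>y. \<not> f2 y \<Longrightarrow> (\<Sum>j<s2. (b2 y j)\<^sup>2) \<le> real s2"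
    and ab2: "\<And>x y. f2 x \<Longrightarrow> \<not> f2 y \<Longrightarrow>
        (\<Sum>j<s2. if x (l2 j) \<noteq> y (l2 j) then a2 x j * b2 y j else 0) = 1"
    using assms(2) unfolding leaf_weights_def by blast
  define lab where "lab j = (if j < s1 then l1 j else l2 (j - s1))" for j
  define \<alpha> where "\<alpha> x j = (if f1 x then if j < s1 then a1 x j else 0
      else if j < s1 then 0 else a2 x (j - s1))" for x j
  define \<beta> where "\<beta> y j = (if j < s1 then b1 y j else b2 y (j - s1))" for y j
  note defs = lab_def \<alpha>_def \<beta>_def
  have "lab j \<in> A1 \<union> A2" if "j < s1 + s2" for j
    using that l1 l2 by (auto simp: lab_def)
  moreover have "(\<Sum>j<s1+s2. (\<alpha> x j)\<^sup>2) \<le> 1" if "f1 x \<or> f2 x" for x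
    using that a1[of x] a2[of x] by (cases "f1 x") (auto simp: sum_lessThan_add_split \<alpha>_def)
  moreover have "(\<Sum>j<s1+s2. (\<beta> y j)\<^sup>2) \<le> real (s1 + s2)" if "\<not> (f1 y \<or> f2 y)" for y
    using that b1[of y] b2[of y] by (auto simp: sum_lessThan_add_split \<beta>_def)
  moreover have "(\<Sum>j<s1+s2. if x (lab j) \<noteq> y (lab j) then \<alpha> x j * \<beta> y j else 0) = 1"
    if "f1 x \<or> f2 x" "\<not> (f1 y \<or> f2 y)" for x y
  proof (cases "f1 x")
    case True
    have "(\<Sum>j<s1+s2. if x (lab j) \<noteq> y (lab j) then \<alpha> x j * \<beta> y j else 0)
      = (\<Sum>j<s1. if x (l1 j) \<noteq> y (l1 j) then a1 x j * b1 y j else 0) + 0"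
      unfolding sum_lessThan_add_split using True
      by (intro arg_cong2[of _ _ _ _ "(+)"] sum.cong sum.neutral) (auto simp: defs)
    then show ?thesis using ab1[of x y] that True by simp
  next
    case False
    have "(\<Sum>j<s1+s2. if x (lab j) \<noteq> y (lab j) then \<alpha> x j * \<beta> y j else 0)
      = 0 + (\<Sum>j<s2. if x (l2 j) \<noteq> y (l2 j) then a2 x j * b2 y j else 0)"
      unfolding sum_lessThan_add_split using False
      by (intro arg_cong2[of _ _ _ _ "(+)"] sum.cong sum.neutral) (auto simp: defs)
    then show ?thesis using ab2[of x y] that False by simp
  qed
  ultimately show ?thesis unfolding leaf_weights_def
    by (intro exI[of _ lab] exI[of _ \<alpha>] exI[of _ \<beta>] conjI allI impI) simp_all
qed

lemma fsize_pos: "fsize F > 0"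
  by (induction F) auto

lemma leaf_weights_feval: "leaf_weights (\<lambda>x. feval x F) (fsize F) (fleaves F)"
proof (induction F)
  case (Leaf a)
  show ?case unfolding leaf_weights_def
    by (intro exI[of _ "\<lambda>_. a"] exI[of _ "\<lambda>_ _. 1"]) auto
next
  case (FAnd p q)
  have "leaf_weights (\<lambda>x. \<not> (\<not> feval x p \<or> \<not> feval x q)) (fsize p + fsize q) (fleaves p \<union> fleaves q)"
    by (intro leaf_weights_not leaf_weights_or FAnd) (auto simp: fsize_pos)
  then show ?case by simp
next
  case (FOr p q)
  then show ?case using leaf_weights_or by simp
next
  case (FNot p)
  then show ?case using leaf_weights_not[OF _ fsize_pos] by simp
qed

section \<open>Inner products and a reflection fixing given vectors\<close>

definition ip :: "'i set \<Rightarrow> ('i \<Rightarrow> real) \<Rightarrow> ('i \<Rightarrow> real) \<Rightarrow> real" where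
  "ip I u v = (\<Sum>i\<in>I. u i * v i)"

definition mv :: "'i set \<Rightarrow> ('i \<Rightarrow> 'i \<Rightarrow> real) \<Rightarrow> ('i \<Rightarrow> real) \<Rightarrow> 'i \<Rightarrow> real" where
  "mv I M v = (\<lambda>i. \<Sum>j\<in>I. M i j * v j)"

lemma ip_cong: "(\<And>i. i \<in> I \<Longrightarrow> u i = u' i) \<Longrightarrow> (\<And>i. i \<in> I \<Longrightarrow> v i = v' i) \<Longrightarrow> ip I u v = ip I u' v'"
  unfolding ip_def by (intro sum.cong) auto

lemma mv_cong: "(\<And>i. i \<in> I \<Longrightarrow> u i = u' i) \<Longrightarrow> mv I M u = mv I M u'"
  unfolding mv_def by (intro ext sum.cong) auto

lemma ip_commute: "ip I u v = ip I v u"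
  by (simp add: ip_def mult.commute)

lemma ip_lin:
  "ip I (\<lambda>i. a * u i + b * v i) w = a * ip I u w + b * ip I v w"
  "ip I w (\<lambda>i. a * u i + b * v i) = a * ip I w u + b * ip I w v"
  by (auto simp: ip_def algebra_simps sum.distrib sum_distrib_left)

lemma mv_lin: "mv I M (\<lambda>i. a * u i + b * v i) = (\<lambda>i. a * mv I M u i + b * mv I M v i)"
  by (auto simp: mv_def algebra_simps sum.distrib sum_distrib_left)

lemma coord_le_ip: "finite I \<Longrightarrow> i \<in> I \<Longrightarrow> (u i)\<^sup>2 \<le> ip I u u"
  unfolding ip_def power2_eq_square by (intro member_le_sum) auto

text \<open>The reflection about the span of \<open>W\<close> is built one vector at a time from
  Householder reflections, with no need for an orthonormal basis. Vectors are total functions, so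
  equations between them are claimed only on \<open>I\<close>.\<close>

lemma reflection_exists:
  assumes "finite W" "finite I"
  shows "\<exists>M. (\<forall>u v. ip I (mv I M u) (mv I M v) = ip I u v) \<and>
     (\<forall>w\<in>W. \<forall>i\<in>I. mv I M w i = w i) \<and>
     (\<forall>v. (\<forall>w\<in>W. ip I w v = 0) \<longrightarrow> (\<forall>i\<in>I. mv I M v i = - v i))"
  using assms(1)
proof (induction W)
  case empty
  have neg: "mv I (\<lambda>i j. if i = j then -1 else 0) v i = - v i" if "i \<in> I" for v i
  proof -
    have "mv I (\<lambda>i j. if i = j then -1 else 0) v i = (\<Sum>j\<in>I. if i = j then - v j else 0)"
      unfolding mv_def by (intro sum.cong) auto
    then show ?thesis using that \<open>finite I\<close> by simp
  qed
  show ?case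
    by (rule exI[of _ "\<lambda>i j. if i = j then -1 else 0"]) (auto simp: neg ip_def)
next
  case (insert w W)
  obtain M where iso: "\<And>u v. ip I (mv I M u) (mv I M v) = ip I u v"
    and fixW: "\<And>w i. w \<in> W \<Longrightarrow> i \<in> I \<Longrightarrow> mv I M w i = w i"
    and neg: "\<And>v i. (\<And>w. w \<in> W \<Longrightarrow> ip I w v = 0) \<Longrightarrow> i \<in> I \<Longrightarrow> mv I M v i = - v i"
    using insert.IH by blast
  \<comment> \<open>Twice the component of \<open>w\<close> orthogonal to the old span; it vanishes
    on \<open>I\<close> exactly when \<open>w\<close> is already fixed.\<close>
  define d where "d = (\<lambda>i. 1 * w i + (-1) * mv I M w i)"
  have dW: "ip I u d = 0" if "u \<in> W" for u
  proof -
    have "ip I u (mv I M w) = ip I (mv I M u) (mv I M w)"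
      by (rule ip_cong) (auto simp: fixW that)
    then show ?thesis unfolding d_def ip_lin by (simp add: iso)
  qed
  have Md: "mv I M d i = - d i" if "i \<in> I" for i
    using neg dW that by blast
  have MMw: "mv I M (mv I M w) i = w i" if "i \<in> I" for i
  proof -
    have "mv I M d i = mv I M w i - mv I M (mv I M w) i"
      unfolding d_def mv_lin by simp
    then show ?thesis using Md[OF that] by (simp add: d_def)
  qed
  have dd: "ip I d d = 2 * ip I d w"
  proof -
    have "ip I d (mv I M w) = - ip I d w"
      unfolding d_def ip_lin iso by (simp add: ip_commute)
    then have "ip I d (\<lambda>i. 1 * w i + (-1) * mv I M w i) = 2 * ip I d w"
      unfolding ip_lin by simp
    then show ?thesis by (simp add: d_def)
  qed
  have d_orth: "ip I d v = 0" if "\<And>u. u \<in> insert w W \<Longrightarrow> ip I u v = 0" for v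
  proof -
    have "ip I (mv I M w) v = - ip I (mv I M w) (mv I M v)"
      unfolding ip_def sum_negf[symmetric] by (intro sum.cong) (auto simp: neg that)
    then show ?thesis unfolding d_def ip_lin by (simp add: iso that)
  qed
  show ?case
  proof (cases "ip I d d = 0")
    case True
    have "d i = 0" if "i \<in> I" for i
      using coord_le_ip[OF \<open>finite I\<close> that, of d] True by simp
    then have "mv I M w i = w i" if "i \<in> I" for i using that by (auto simp: d_def)
    then show ?thesis using iso fixW neg by (intro exI[of _ M]) auto
  next
    case False
    \<comment> \<open>\<open>H\<close> is the Householder reflection along \<open>d\<close>. Since
      \<open>dd\<close> says that d.d = 2 d.w, it sends \<open>w\<close> to \<open>M w\<close>,
      which \<open>M\<close> sends back to \<open>w\<close>. Because \<open>M d = -d\<close>, the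
      product of \<open>M\<close> and \<open>H\<close> is the rank-one update
      \<open>M'\<close>.\<close>
    define q where "q = 2 / ip I d d"
    define H where "H v = (\<lambda>i. 1 * v i + (- q * ip I d v) * d i)" for v
    define M' where "M' i j = M i j + q * d i * d j" for i j
    have M': "mv I M' v i = mv I M (H v) i" if "i \<in> I" for v i
    proof -
      have "mv I M (H v) i = mv I M v i + q * ip I d v * d i"
        unfolding H_def mv_lin using Md[OF that] by simp
      moreover have "mv I M' v i = mv I M v i + q * ip I d v * d i"
        by (simp add: M'_def mv_def ip_def sum.distrib algebra_simps sum_distrib_left)
      ultimately show ?thesis by simp
    qed
    have isoH: "ip I (H u) (H v) = ip I u v" for u v
    proof -
      have "ip I (H u) (H v) = ip I u v - 2 * q * ip I d u * ip I d v + q * q * ip I d u * ip I d v * ip I d d"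
        unfolding H_def ip_lin by (simp add: ip_commute[of _ u d] ip_commute[of _ v d] algebra_simps)
      then show ?thesis using False by (simp add: q_def)
    qed
    have "ip I (mv I M' u) (mv I M' v) = ip I u v" for u v
    proof -
      have "ip I (mv I M' u) (mv I M' v) = ip I (mv I M (H u)) (mv I M (H v))"
        by (rule ip_cong) (auto simp: M')
      then show ?thesis by (simp add: iso isoH)
    qed
    moreover have "mv I M' u i = u i" if "u \<in> insert w W" "i \<in> I" for u i
    proof (cases "u = w")
      case True
      have "H w = mv I M w"
        using dd False by (auto simp: H_def q_def d_def)
      then show ?thesis using True that by (simp add: M' MMw)
    next
      case False
      then have "u \<in> W" using that by simp
      then have "H u = u" using dW[of u] by (simp add: H_def ip_commute)
      then show ?thesis using \<open>u \<in> W\<close> that by (simp add: M' fixW)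
    qed
    moreover have "mv I M' v i = - v i" if "\<And>u. u \<in> insert w W \<Longrightarrow> ip I u v = 0" "i \<in> I" for v i
    proof -
      have "H v = v" using d_orth[OF that(1)] by (simp add: H_def)
      then show ?thesis using that neg by (simp add: M')
    qed
    ultimately show ?thesis by (intro exI[of _ M']) blast
  qed
qed

section \<open>Approximating formulas of size s by degree sqrt s\<close>

text \<open>In the application \<open>M\<close> is the same for all inputs and only the diagonal
  \<open>d\<close> reads the input, so one step raises the degree by at most one.\<close>

definition walk :: "'i set \<Rightarrow> ('i \<Rightarrow> 'i \<Rightarrow> real) \<Rightarrow> ('i \<Rightarrow> real) \<Rightarrow> ('i \<Rightarrow> real) \<Rightarrow> 'i \<Rightarrow> real" where
  "walk I M d v = (\<lambda>i. d i * mv I M v i)"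

lemma walk_pow_lin:
  "(walk I M d ^^ t) (\<lambda>i. a * u i + b * v i) =
   (\<lambda>i. a * (walk I M d ^^ t) u i + b * (walk I M d ^^ t) v i)"
proof (induction t)
  case (Suc t)
  then show ?case by (simp add: walk_def mv_lin algebra_simps)
qed simp

lemma walk_pow_cong:
  assumes "\<And>i. i \<in> I \<Longrightarrow> u i = v i" "i \<in> I"
  shows "(walk I M d ^^ t) u i = (walk I M d ^^ t) v i"
  using assms(2)
proof (induction t arbitrary: i)
  case (Suc t)
  then have "mv I M ((walk I M d ^^ t) u) = mv I M ((walk I M d ^^ t) v)"
    by (intro mv_cong) auto
  then show ?case by (simp add: walk_def[of I M d "(walk I M d ^^ t) _"])
qed (use assms in simp)

lemma walk_pow_iso:
  assumes "\<And>u v. ip I (mv I M u) (mv I M v) = ip I u v" "\<And>i. d i * d i = 1"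
  shows "ip I ((walk I M d ^^ t) u) ((walk I M d ^^ t) u) = ip I u u"
proof (induction t)
  case (Suc t)
  let ?u = "(walk I M d ^^ t) u"
  have "d i * x * (d i * x) = x * x" for i x
    using assms(2)[of i] by (metis mult.assoc mult.commute mult.right_neutral)
  then have "ip I (walk I M d ?u) (walk I M d ?u) = ip I (mv I M ?u) (mv I M ?u)"
    unfolding walk_def[of I M d ?u] ip_def by presburger
  then show ?case using Suc assms(1) by simp
qed simp

lemma walk_coord_le:
  assumes "\<And>u v. ip I (mv I M u) (mv I M v) = ip I u v" "\<And>i. d i * d i = 1"
    and "finite I" "i \<in> I"
  shows "\<bar>(walk I M d ^^ t) u i\<bar> \<le> sqrt (ip I u u)"
  using coord_le_ip[OF assms(3,4), of "(walk I M d ^^ t) u"]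
  by (simp add: walk_pow_iso[OF assms(1,2)] real_le_rsqrt)

text \<open>Writing U for the step, the hypothesis reads 2e = v - Uv, so the powers of U applied to
  \<open>e\<close> telescope. The sum is thus bounded in terms of the norm of \<open>v\<close>,
  however large \<open>\<tau>\<close> is.\<close>

lemma walk_sum_telescope:
  assumes "\<And>i. i \<in> I \<Longrightarrow> walk I M d v i = v i - 2 * e i" "i \<in> I"
  shows "2 * (\<Sum>t<\<tau>. (walk I M d ^^ t) e i) = v i - (walk I M d ^^ \<tau>) v i"
proof (induction \<tau>)
  case (Suc \<tau>)
  have "(walk I M d ^^ Suc \<tau>) v i = (walk I M d ^^ \<tau>) (walk I M d v) i"
    by (simp add: funpow_swap1)
  also have "\<dots> = (walk I M d ^^ \<tau>) (\<lambda>i. 1 * v i + (-2) * e i) i"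
    by (rule walk_pow_cong) (use assms in auto)
  also have "\<dots> = (walk I M d ^^ \<tau>) v i - 2 * (walk I M d ^^ \<tau>) e i"
    by (simp only: walk_pow_lin)
  finally show ?case using Suc by simp
qed simp

lemma walk_pow_fixed:
  assumes "\<And>i. i \<in> I \<Longrightarrow> walk I M d w i = w i" "i \<in> I"
  shows "(walk I M d ^^ t) w i = w i"
proof (induction t)
  case (Suc t)
  have "(walk I M d ^^ Suc t) w i = (walk I M d ^^ t) (walk I M d w) i"
    by (simp add: funpow_swap1)
  also have "\<dots> = (walk I M d ^^ t) w i"
    by (rule walk_pow_cong) (use assms in auto)
  finally show ?case using Suc by simp
qed simp

definition sg :: "bool \<Rightarrow> real" where "sg b = (if b then - 1 else 1)"

text \<open>The degree of \<open>p\<close> enters only by duality: instead of writing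
  \<open>p\<close> as a polynomial, the lemma says that signed weights annihilating all products of
  fewer than \<open>\<tau>\<close> leaf signs annihilate \<open>p\<close> as well.\<close>

lemma formula_approximation:
  fixes F :: "'a dmformula" and z :: "'x \<Rightarrow> 'a \<Rightarrow> bool" and \<mu> :: "'x \<Rightarrow> real"
  assumes X: "finite X" and \<tau>: "real \<tau> \<ge> 4 * sqrt (1 + 16 * real (fsize F))"
    and \<mu>: "\<And>L. set L \<subseteq> fleaves F \<Longrightarrow> length L < \<tau> \<Longrightarrow>
              (\<Sum>x\<in>X. \<mu> x * (\<Prod>l\<leftarrow>L. sg (z x l))) = 0"
  shows "\<exists>p. (\<forall>x\<in>X. \<bar>p x\<bar> \<le> 1 \<and> (feval (z x) F \<longrightarrow> p x \<ge> 3/4) \<and> (\<not> feval (z x) F \<longrightarrow> p x \<le> 1/4))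
           \<and> (\<Sum>x\<in>X. \<mu> x * p x) = 0"
proof -
  define s where "s = fsize F"
  obtain lab \<alpha> \<beta> where lab: "\<And>j. j < s \<Longrightarrow> lab j \<in> fleaves F"
    and a: "\<And>x. feval x F \<Longrightarrow> (\<Sum>j<s. (\<alpha> x j)\<^sup>2) \<le> (1::real)"
    and b: "\<And>y. \<not> feval y F \<Longrightarrow> (\<Sum>j<s. (\<beta> y j)\<^sup>2) \<le> real s"
    and ab: "\<And>x y. feval x F \<Longrightarrow> \<not> feval y F \<Longrightarrow>
        (\<Sum>j<s. if x (lab j) \<noteq> y (lab j) then \<alpha> x j * \<beta> y j else 0) = 1"
    using leaf_weights_feval[of F] unfolding leaf_weights_def s_def by blast
  \<comment> \<open>\<open>None\<close> indexes the start vector; \<open>Some (j, b)\<close> stands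
    for leaf position \<open>j\<close> reading the value \<open>b\<close>.\<close>
  define I where "I = insert None (Some ` ({..<s} \<times> (UNIV :: bool set)))"
  have I: "finite I" "None \<in> I" by (auto simp: I_def)
  have sumI: "(\<Sum>i\<in>I. h i) = h None + (\<Sum>j<s. h (Some (j, True)) + h (Some (j, False)))"
    for h :: "(nat \<times> bool) option \<Rightarrow> real"
  proof -
    have "(\<Sum>i\<in>I. h i) = h None + (\<Sum>i\<in>Some ` ({..<s} \<times> UNIV). h i)"
      unfolding I_def by (subst sum.insert) auto
    also have "(\<Sum>i\<in>Some ` ({..<s} \<times> UNIV). h i) = (\<Sum>jb\<in>{..<s} \<times> UNIV. h (Some jb))"
      by (subst sum.reindex) auto
    also have "\<dots> = (\<Sum>j<s. \<Sum>b\<in>UNIV. h (Some (j, b)))"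
      by (simp add: sum.cartesian_product)
    finally show ?thesis by (simp add: UNIV_bool add.commute)
  qed
  define e :: "(nat \<times> bool) option \<Rightarrow> real" where "e i = (if i = None then 1 else 0)" for i
  \<comment> \<open>The supports of \<open>\<delta> x\<close> and \<open>v y\<close> meet at a leaf
    only if \<open>x\<close> and \<open>y\<close> differ there, so the total mass 1 on differing
    leaves makes \<open>w x\<close> and \<open>v y\<close> orthogonal; the factors 1/4 and -4
    cancel. The 1/4 keeps \<open>w x\<close> within 1/4 of \<open>e\<close>, at the price of the 16
    in the norm of \<open>v y\<close>.\<close>
  define \<delta> where "\<delta> x i = (case i of None \<Rightarrow> 0 | Some (j, b) \<Rightarrow> if z x (lab j) = b then \<alpha> (z x) j / 4 else 0)"
    for x and i :: "(nat \<times> bool) option"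
  define w where "w x i = e i + \<delta> x i" for x i
  define v where "v y i = (case i of None \<Rightarrow> 1 | Some (j, b) \<Rightarrow> if z y (lab j) = b then 0 else - 4 * \<beta> (z y) j)"
    for y and i :: "(nat \<times> bool) option"
  define d where "d x i = (case i of None \<Rightarrow> 1 | Some (j, b) \<Rightarrow> if z x (lab j) = b then 1 else (- 1 :: real))"
    for x and i :: "(nat \<times> bool) option"
  have dd: "d x i * d x i = 1" for x i by (auto simp: d_def split: option.splits)
  have wv: "ip I (w x) (v y) = 0" if "feval (z x) F" "\<not> feval (z y) F" for x y
  proof -
    have "ip I (w x) (v y) = 1 + (\<Sum>j<s. - (if z x (lab j) \<noteq> z y (lab j) then \<alpha> (z x) j * \<beta> (z y) j else 0))"
      unfolding ip_def sumI by (auto simp: w_def v_def e_def \<delta>_def intro!: sum.cong)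
    then show ?thesis using ab[OF that] by (simp add: sum_negf)
  qed
  have ee: "ip I e e = 1" unfolding ip_def sumI by (simp add: e_def)
  have \<delta>\<delta>: "ip I (\<delta> x) (\<delta> x) \<le> (1/4)\<^sup>2" if "feval (z x) F" for x
  proof -
    have "ip I (\<delta> x) (\<delta> x) = (\<Sum>j<s. (\<alpha> (z x) j)\<^sup>2 / 16)"
      unfolding ip_def sumI by (auto simp: \<delta>_def power2_eq_square intro!: sum.cong)
    then show ?thesis using a[OF that] by (simp add: sum_divide_distrib[symmetric] power2_eq_square)
  qed
  have vv: "ip I (v y) (v y) \<le> 1 + 16 * real s" if "\<not> feval (z y) F" for y
  proof -
    have "ip I (v y) (v y) = 1 + (\<Sum>j<s. 16 * (\<beta> (z y) j)\<^sup>2)"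
      unfolding ip_def sumI by (auto simp: v_def power2_eq_square intro!: sum.cong)
    then show ?thesis using b[OF that] by (simp add: sum_distrib_left[symmetric])
  qed
  obtain M where iso: "\<And>u v. ip I (mv I M u) (mv I M v) = ip I u v"
    and fixw: "\<And>x i. x \<in> X \<Longrightarrow> feval (z x) F \<Longrightarrow> i \<in> I \<Longrightarrow> mv I M (w x) i = w x i"
    and neg: "\<And>v i. (\<And>x. x \<in> X \<Longrightarrow> feval (z x) F \<Longrightarrow> ip I (w x) v = 0) \<Longrightarrow> i \<in> I \<Longrightarrow> mv I M v i = - v i"
    using reflection_exists[of "w ` {x\<in>X. feval (z x) F}" I] X I(1) by auto blast
  define U where "U x = walk I M (d x)" for x
  define p where "p x = (\<Sum>t<\<tau>. (U x ^^ t) e None) / real \<tau>" for x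
  have "1 \<le> sqrt (1 + 16 * real s)" by simp
  then have \<tau>0: "real \<tau> > 0" using \<tau> unfolding s_def by linarith
  have coord: "\<bar>(U x ^^ t) u None\<bar> \<le> sqrt (ip I u u)" for x t u
    unfolding U_def by (rule walk_coord_le[OF iso dd I])
  have p1: "\<bar>p x\<bar> \<le> 1" for x
  proof -
    have "\<bar>\<Sum>t<\<tau>. (U x ^^ t) e None\<bar> \<le> (\<Sum>t<\<tau>. 1)"
      by (rule order_trans[OF sum_abs], rule sum_mono) (use coord[of _ x e] ee in simp)
    then show ?thesis using \<tau>0 by (simp add: p_def abs_divide)
  qed
  have pT: "p x \<ge> 3/4" if "x \<in> X" "feval (z x) F" for x
  proof -
    \<comment> \<open>The diagonal \<open>d x\<close> is +1 on the whole support of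
      \<open>w x\<close>.\<close>
    have fx: "walk I M (d x) (w x) i = w x i" if "i \<in> I" for i
      using fixw[OF \<open>x \<in> X\<close> \<open>feval (z x) F\<close> that]
      by (auto simp: walk_def d_def w_def e_def \<delta>_def split: option.splits)
    have "(U x ^^ t) e None \<ge> 3/4" for t
    proof -
      have "(U x ^^ t) e None = (U x ^^ t) (\<lambda>i. 1 * w x i + (-1) * \<delta> x i) None"
        by (simp add: w_def)
      also have "\<dots> = (U x ^^ t) (w x) None - (U x ^^ t) (\<delta> x) None"
        unfolding U_def walk_pow_lin by simp
      also have "(U x ^^ t) (w x) None = 1"
        unfolding U_def using walk_pow_fixed[OF fx I(2)] by (simp add: w_def e_def \<delta>_def)
      finally have "(U x ^^ t) e None = 1 - (U x ^^ t) (\<delta> x) None" .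
      moreover have "sqrt (ip I (\<delta> x) (\<delta> x)) \<le> 1/4"
        using \<delta>\<delta>[OF that(2)] by (intro real_le_lsqrt) auto
      ultimately show ?thesis using coord[of t x "\<delta> x"] by linarith
    qed
    then have "(\<Sum>t<\<tau>. (U x ^^ t) e None) \<ge> (\<Sum>t<\<tau>. 3/4)" by (intro sum_mono) auto
    then show ?thesis using \<tau>0 by (simp add: p_def field_simps)
  qed
  have pF: "p x \<le> 1/4" if "\<not> feval (z x) F" for x
  proof -
    \<comment> \<open>\<open>M\<close> negates \<open>v x\<close>; the diagonal then negates the
      leaf coordinates of its support once more but leaves coordinate \<open>None\<close> alone. The
      net change is -2 at \<open>None\<close>.\<close>
    have "mv I M (v x) i = - v x i" if "i \<in> I" for i
      using wv \<open>\<not> feval (z x) F\<close> by (intro neg that)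
    then have "walk I M (d x) (v x) i = v x i - 2 * e i" if "i \<in> I" for i
      using that by (auto simp: walk_def d_def v_def e_def split: option.splits)
    from walk_sum_telescope[OF this I(2), of \<tau>]
    have "2 * (\<Sum>t<\<tau>. (U x ^^ t) e None) = v x None - (U x ^^ \<tau>) (v x) None"
      by (simp add: U_def)
    moreover have "sqrt (ip I (v x) (v x)) \<le> sqrt (1 + 16 * real s)"
      using vv[OF that] by simp
    moreover have "4 * sqrt (1 + 16 * real s) \<le> real \<tau>" using \<tau> by (simp add: s_def)
    \<comment> \<open>Both end terms of the telescoped sum are at most the norm of
      \<open>v x\<close>, the first one being the case of zero steps.\<close>
    ultimately have "4 * (\<Sum>t<\<tau>. (U x ^^ t) e None) \<le> real \<tau>"
      using coord[of \<tau> x "v x"] coord[of 0 x "v x"]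
      unfolding abs_le_iff funpow_0 by linarith
    then show ?thesis using \<tau>0 by (simp add: p_def field_simps)
  qed
  \<comment> \<open>Generalised for the induction: \<open>L\<close> collects the signs of the steps
    already peeled off, and \<open>i\<close> is the coordinate reached. Peeling off one step moves
    at most one sign into \<open>L\<close>, up to a constant.\<close>
  have deg: "(\<Sum>x\<in>X. \<mu> x * (\<Prod>l\<leftarrow>L. sg (z x l)) * (U x ^^ t) e i) = 0"
    if "set L \<subseteq> fleaves F" "length L + t < \<tau>" "i \<in> I" for L t i
    using that
  proof (induction t arbitrary: L i)
    case 0
    then show ?case using \<mu>[of L] by (simp add: sum_distrib_right[symmetric])
  next
    case (Suc t)
    obtain L' c where L': "set L' \<subseteq> fleaves F" "length L' + t < \<tau>"
      and c: "\<And>x. (\<Prod>l\<leftarrow>L. sg (z x l)) * d x i = c * (\<Prod>l\<leftarrow>L'. sg (z x l))"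
    proof (cases i)
      case None
      then show thesis using Suc.prems by (intro that[of L 1]) (auto simp: d_def)
    next
      case (Some jb)
      then obtain j b where i: "i = Some (j, b)" "j < s" using Suc.prems by (auto simp: I_def)
      have "d x i = sg b * sg (z x (lab j))" for x by (simp add: i d_def sg_def)
      then show thesis using Suc.prems lab[OF i(2)] by (intro that[of "lab j # L" "sg b"]) auto
    qed
    have "(\<Sum>x\<in>X. \<mu> x * (\<Prod>l\<leftarrow>L. sg (z x l)) * (U x ^^ Suc t) e i)
        = (\<Sum>x\<in>X. \<mu> x * ((\<Prod>l\<leftarrow>L. sg (z x l)) * d x i) * (\<Sum>j\<in>I. M i j * (U x ^^ t) e j))"
      by (simp add: U_def walk_def mv_def mult.assoc)
    also have "\<dots> = (\<Sum>x\<in>X. \<Sum>j\<in>I. c * M i j * (\<mu> x * (\<Prod>l\<leftarrow>L'. sg (z x l)) * (U x ^^ t) e j))"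
      unfolding c by (simp add: sum_distrib_left mult_ac)
    also have "\<dots> = (\<Sum>j\<in>I. c * M i j * (\<Sum>x\<in>X. \<mu> x * (\<Prod>l\<leftarrow>L'. sg (z x l)) * (U x ^^ t) e j))"
      by (subst sum.swap) (simp add: sum_distrib_left)
    also have "\<dots> = 0" by (intro sum.neutral ballI) (simp add: Suc.IH[OF L'])
    finally show ?case .
  qed
  have "(\<Sum>x\<in>X. \<mu> x * p x) = (\<Sum>x\<in>X. \<Sum>t<\<tau>. \<mu> x * (\<Prod>l\<leftarrow>[]. sg (z x l)) * (U x ^^ t) e None) / real \<tau>"
    by (simp add: p_def sum_divide_distrib sum_distrib_left)
  also have "\<dots> = 0"
    by (subst sum.swap) (use deg[of "[]"] I in simp)
  finally have "(\<Sum>x\<in>X. \<mu> x * p x) = 0" .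
  then show ?thesis using p1 pT pF by (intro exI[of _ p]) auto
qed

section \<open>Circuits\<close>

definition wf_gates :: "nat \<Rightarrow> gate list \<Rightarrow> bool" where
  "wf_gates m gs \<longleftrightarrow> (\<forall>j < length gs. \<forall>w \<in> gate_inputs (gs ! j). w < m + j)"

lemma wire_vals_snoc:
  "wire_vals m (gs @ [g]) a = wire_vals m gs a @ [gate_val (wire_vals m gs a) g]"
  by (simp add: wire_vals_def)

lemma length_wire_vals: "length (wire_vals m gs a) = m + length gs"
  by (induction gs rule: rev_induct) (simp add: wire_vals_def, simp add: wire_vals_snoc)

lemma wire_vals_append_nth:
  "w < m + length gs \<Longrightarrow> wire_vals m (gs @ gs') a ! w = wire_vals m gs a ! w"
proof (induction gs' rule: rev_induct)
  case (snoc g gs')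
  then show ?case
    by (simp only: append_assoc[symmetric] wire_vals_snoc)
       (simp add: nth_append length_wire_vals)
qed simp

lemma wf_gates_snoc:
  "wf_gates m (gs @ [g]) \<longleftrightarrow> wf_gates m gs \<and> (\<forall>w\<in>gate_inputs g. w < m + length gs)"
  by (auto simp: wf_gates_def nth_append less_Suc_eq)

lemma wire_vals_snoc_last:
  "wire_vals m (gs @ [g]) a ! (m + length gs) = gate_val (wire_vals m gs a) g"
  by (simp add: wire_vals_snoc nth_append length_wire_vals)

text \<open>Quantifying over the gates \<open>gs\<close> already present makes the notion compositional:
  each subcircuit is appended to the gates of the previous ones.\<close>

definition ckt :: "nat \<Rightarrow> nat \<Rightarrow> ((nat \<Rightarrow> bool) \<Rightarrow> bool) \<Rightarrow> bool" where
  "ckt m k f \<longleftrightarrow> (\<forall>gs. wf_gates m gs \<longrightarrow> (\<exists>gs' w. length gs' \<le> k \<and> wf_gates m (gs @ gs') \<and>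
     w < m + length (gs @ gs') \<and> (\<forall>a. wire_vals m (gs @ gs') a ! w = f a)))"

lemma ckt_mono: "ckt m k f \<Longrightarrow> k \<le> k' \<Longrightarrow> ckt m k' f"
  unfolding ckt_def by (meson order_trans)

lemma ckt_input: "j < m \<Longrightarrow> ckt m 0 (\<lambda>a. a j)"
  unfolding ckt_def
proof (intro allI impI)
  fix gs assume "j < m" "wf_gates m gs"
  moreover have "wire_vals m gs a ! j = a j" for a
    using wire_vals_append_nth[of j m "[]" gs a] \<open>j < m\<close> by (simp add: wire_vals_def)
  ultimately show "\<exists>gs' w. length gs' \<le> 0 \<and> wf_gates m (gs @ gs') \<and>
     w < m + length (gs @ gs') \<and> (\<forall>a. wire_vals m (gs @ gs') a ! w = a j)"
    by (intro exI[of _ "[]"] exI[of _ j]) auto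
qed

lemma ckt_not:
  assumes "ckt m k f"
  shows "ckt m (k + 1) (\<lambda>a. \<not> f a)"
  unfolding ckt_def
proof (intro allI impI)
  fix gs assume "wf_gates m gs"
  then obtain gs' w where *: "length gs' \<le> k" "wf_gates m (gs @ gs')" "w < m + length (gs @ gs')"
    "\<And>a. wire_vals m (gs @ gs') a ! w = f a"
    using assms unfolding ckt_def by blast
  have "wf_gates m ((gs @ gs') @ [GNot w])"
    using * by (simp only: wf_gates_snoc) simp
  moreover have "wire_vals m ((gs @ gs') @ [GNot w]) a ! (m + length (gs @ gs')) = (\<not> f a)" for a
    by (simp only: wire_vals_snoc_last) (simp add: *(4))
  ultimately show "\<exists>gs' w. length gs' \<le> k + 1 \<and> wf_gates m (gs @ gs') \<and>
     w < m + length (gs @ gs') \<and> (\<forall>a. wire_vals m (gs @ gs') a ! w = (\<not> f a))"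
    using *(1) by (intro exI[of _ "gs' @ [GNot w]"] exI[of _ "m + length (gs @ gs')"]) simp
qed

lemma ckt_two:
  assumes "ckt m k1 f1" "ckt m k2 f2" "wf_gates m gs"
  obtains gs' u v where "length gs' \<le> k1 + k2" "wf_gates m (gs @ gs')"
    "u < m + length (gs @ gs')" "v < m + length (gs @ gs')"
    "\<And>a. wire_vals m (gs @ gs') a ! u = f1 a" "\<And>a. wire_vals m (gs @ gs') a ! v = f2 a"
proof -
  obtain g1 u where *: "length g1 \<le> k1" "wf_gates m (gs @ g1)" "u < m + length (gs @ g1)"
    "\<And>a. wire_vals m (gs @ g1) a ! u = f1 a"
    using assms unfolding ckt_def by blast
  obtain g2 v where **: "length g2 \<le> k2" "wf_gates m ((gs @ g1) @ g2)" "v < m + length ((gs @ g1) @ g2)"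
    "\<And>a. wire_vals m ((gs @ g1) @ g2) a ! v = f2 a"
    using assms(2) *(2) unfolding ckt_def by blast
  show thesis
  proof (rule that[of "g1 @ g2" u v])
    show "wire_vals m (gs @ (g1 @ g2)) a ! u = f1 a" for a
      using wire_vals_append_nth[OF *(3), of g2 a] *(4) by simp
  qed (use * ** in auto)
qed

lemma ckt_and:
  assumes "ckt m k1 f1" "ckt m k2 f2"
  shows "ckt m (k1 + k2 + 1) (\<lambda>a. f1 a \<and> f2 a)"
  unfolding ckt_def
proof (intro allI impI)
  fix gs assume "wf_gates m gs"
  from ckt_two[OF assms this] obtain gs' u v where *: "length gs' \<le> k1 + k2" "wf_gates m (gs @ gs')"
    "u < m + length (gs @ gs')" "v < m + length (gs @ gs')"
    "\<And>a. wire_vals m (gs @ gs') a ! u = f1 a" "\<And>a. wire_vals m (gs @ gs') a ! v = f2 a"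
    by blast
  have "wf_gates m ((gs @ gs') @ [GAnd u v])"
    using * by (simp only: wf_gates_snoc) simp
  moreover have "wire_vals m ((gs @ gs') @ [GAnd u v]) a ! (m + length (gs @ gs')) = (f1 a \<and> f2 a)" for a
    by (simp only: wire_vals_snoc_last) (simp add: *)
  ultimately show "\<exists>gs' w. length gs' \<le> k1 + k2 + 1 \<and> wf_gates m (gs @ gs') \<and>
     w < m + length (gs @ gs') \<and> (\<forall>a. wire_vals m (gs @ gs') a ! w = (f1 a \<and> f2 a))"
    using *(1) by (intro exI[of _ "gs' @ [GAnd u v]"] exI[of _ "m + length (gs @ gs')"]) simp
qed

lemma ckt_xor:
  assumes "ckt m k1 f1" "ckt m k2 f2"
  shows "ckt m (k1 + k2 + 4) (\<lambda>a. f1 a \<noteq> f2 a)"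
  unfolding ckt_def
proof (intro allI impI)
  fix gs assume "wf_gates m gs"
  from ckt_two[OF assms this] obtain gs' u v where *: "length gs' \<le> k1 + k2" "wf_gates m (gs @ gs')"
    "u < m + length (gs @ gs')" "v < m + length (gs @ gs')"
    "\<And>a. wire_vals m (gs @ gs') a ! u = f1 a" "\<And>a. wire_vals m (gs @ gs') a ! v = f2 a"
    by blast
  \<comment> \<open>The gates on wires \<open>q\<close> to \<open>q + 3\<close> are OR, AND, the
    negation of that AND, and the conjunction of the first and the third.\<close>
  define q where "q = m + length (gs @ gs')"
  define g1 where "g1 = (gs @ gs') @ [GOr u v]"
  define g2 where "g2 = g1 @ [GAnd u v]"
  define g3 where "g3 = g2 @ [GNot (q + 1)]"
  define g4 where "g4 = g3 @ [GAnd q (q + 2)]"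
  have len: "m + length g1 = q + 1" "m + length g2 = q + 2" "m + length g3 = q + 3" "m + length g4 = q + 4"
    by (simp_all add: g1_def g2_def g3_def g4_def q_def)
  have uv: "u < q" "v < q" using * by (auto simp: q_def)
  have "wf_gates m g4"
    unfolding g4_def g3_def g2_def wf_gates_snoc len[unfolded g4_def g3_def g2_def]
    unfolding g1_def wf_gates_snoc using * uv by (auto simp: q_def)
  moreover have "wire_vals m g4 a ! (q + 3) = (f1 a \<noteq> f2 a)" for a
  proof -
    have 1: "wire_vals m g1 a ! q = (f1 a \<or> f2 a)"
      unfolding g1_def q_def wire_vals_snoc_last by (simp add: *)
    have "wire_vals m g1 a ! w = wire_vals m (gs @ gs') a ! w" if "w < q" for w
      unfolding g1_def using that by (intro wire_vals_append_nth) (simp add: q_def)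
    then have "wire_vals m g1 a ! u = f1 a" "wire_vals m g1 a ! v = f2 a"
      using * uv by auto
    then have 2: "wire_vals m g2 a ! (q + 1) = (f1 a \<and> f2 a)"
      unfolding g2_def len(1)[symmetric] wire_vals_snoc_last by simp
    have 3: "wire_vals m g2 a ! q = (f1 a \<or> f2 a)"
      unfolding g2_def by (subst wire_vals_append_nth) (use 1 len in auto)
    have 4: "wire_vals m g3 a ! (q + 2) = (\<not> (f1 a \<and> f2 a))"
      unfolding g3_def len(2)[symmetric] wire_vals_snoc_last by (simp only: gate_val.simps 2)
    have 5: "wire_vals m g3 a ! q = (f1 a \<or> f2 a)"
      unfolding g3_def by (subst wire_vals_append_nth) (use 3 len in auto)
    show ?thesis
      unfolding g4_def len(3)[symmetric] wire_vals_snoc_last gate_val.simps 4 5 by blast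
  qed
  moreover have "g4 = gs @ (gs' @ [GOr u v, GAnd u v, GNot (q + 1), GAnd q (q + 2)])"
    by (simp add: g1_def g2_def g3_def g4_def)
  ultimately show "\<exists>gs' w. length gs' \<le> k1 + k2 + 4 \<and> wf_gates m (gs @ gs') \<and>
     w < m + length (gs @ gs') \<and> (\<forall>a. wire_vals m (gs @ gs') a ! w = (f1 a \<noteq> f2 a))"
    using *(1) len(4)
    by (intro exI[of _ "gs' @ [GOr u v, GAnd u v, GNot (q + 1), GAnd q (q + 2)]"] exI[of _ "q + 3"]) auto
qed

text \<open>The gate basis has no constants, so falsity is computed as input 0 conjoined with its
  negation.\<close>

lemma ckt_False: "m > 0 \<Longrightarrow> ckt m 2 (\<lambda>a. False)"
  using ckt_and[OF ckt_input ckt_not[OF ckt_input], of 0 m 0] by (simp add: numeral_2_eq_2)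

lemma ckt_const: "m > 0 \<Longrightarrow> ckt m 3 (\<lambda>a. c)"
  using ckt_not[OF ckt_False, of m] ckt_mono[OF ckt_False, of m 3] by (cases c) auto

lemma odd_card_insert:
  assumes "finite A" "x \<notin> A"
  shows "odd (card {j \<in> insert x A. a j}) = (a x \<noteq> odd (card {j\<in>A. a j}))"
proof -
  have "{j \<in> insert x A. a j} = (if a x then insert x {j\<in>A. a j} else {j\<in>A. a j})" by auto
  then show ?thesis using assms by auto
qed

lemma ckt_parity:
  assumes "m > 0" "finite B" "\<And>j. j \<in> B \<Longrightarrow> ckt m k (f j)"
  shows "ckt m (2 + card B * (k + 4)) (\<lambda>a. odd (card {j\<in>B. f j a}))"
  using assms(2,3)
proof (induction B)
  case empty
  then show ?case using ckt_False[OF \<open>m > 0\<close>] by simp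
next
  case (insert j B)
  have "ckt m (k + (2 + card B * (k + 4)) + 4) (\<lambda>a. f j a \<noteq> odd (card {i\<in>B. f i a}))"
    using insert by (intro ckt_xor) auto
  then show ?case
    unfolding odd_card_insert[OF insert.hyps] using insert.hyps by (simp add: algebra_simps)
qed

lemma ckt_all:
  assumes "m > 0" "\<And>j. j \<in> set js \<Longrightarrow> ckt m k (f j)"
  shows "ckt m (3 + length js * (k + 1)) (\<lambda>a. \<forall>j\<in>set js. f j a)"
  using assms(2)
proof (induction js)
  case Nil
  then show ?case using ckt_const[OF \<open>m > 0\<close>, of True] by simp
next
  case (Cons j js)
  have "ckt m (k + (3 + length js * (k + 1)) + 1) (\<lambda>a. f j a \<and> (\<forall>j\<in>set js. f j a))"
    using Cons by (intro ckt_and) auto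
  then show ?case by (simp add: algebra_simps)
qed

lemma circuit_size_le_ckt:
  assumes "ckt m k f" "k \<le> l" "\<And>i. i < 2 ^ m \<Longrightarrow> tt ! i = f (\<lambda>j. odd (i div 2 ^ j))"
  shows "circuit_size_le m tt l"
proof -
  have "wf_gates m []" by (simp add: wf_gates_def)
  then obtain gs w where "length gs \<le> k" "wf_gates m gs" "w < m + length gs"
    "\<And>a. wire_vals m gs a ! w = f a"
    using assms(1) unfolding ckt_def by (metis append_Nil)
  then show ?thesis using assms(2,3)
    unfolding circuit_size_le_def circuit_computes_def wf_circuit_def wf_gates_def
    by (intro exI[of _ gs] exI[of _ w]) auto
qed

section \<open>Counting truth tables of small circuits\<close>

lemma card_lists_length_le_bound:
  assumes "finite A"
  shows "card {xs. set xs \<subseteq> A \<and> length xs \<le> l} \<le> (card A + 1) ^ l"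
proof -
  have "(\<Sum>i\<le>l. c ^ i) \<le> (c + 1) ^ l" for c :: nat
  proof (induction l)
    case (Suc l)
    have "(\<Sum>i\<le>Suc l. c ^ i) = 1 + c * (\<Sum>i\<le>l. c ^ i)"
      unfolding sum.atMost_Suc_shift by (simp add: sum_distrib_left)
    also have "\<dots> \<le> (c + 1) ^ l + c * (c + 1) ^ l"
      using Suc by (intro add_mono mult_left_mono) auto
    finally show ?case by simp
  qed simp
  then show ?thesis using card_lists_length_le[OF assms] by simp
qed

text \<open>A circuit with at most \<open>l\<close> gates mentions only wires below
  \<open>m + l\<close>, which leaves at most 3(m+l)^2 choices per gate; the extra 1 accounts for
  shorter gate lists and the last factor for the output wire. Decoding covers all easy
  tables.\<close>

lemma card_circuit_size_le:
  assumes "m + l > 0"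
  shows "card {S \<in> Pow {..<2 ^ m}. circuit_size_le m (map (\<lambda>i. i \<in> S) [0..<2 ^ m]) l}
     \<le> (3 * (m + l)\<^sup>2 + 1) ^ l * (m + l)"
proof -
  define q where "q = m + l"
  define G where "G = {g. gate_inputs g \<subseteq> {..<q}}"
  have G: "G = (\<lambda>(u, v). GAnd u v) ` ({..<q} \<times> {..<q}) \<union> (\<lambda>(u, v). GOr u v) ` ({..<q} \<times> {..<q}) \<union> GNot ` {..<q}"
    (is "_ = ?A \<union> ?B \<union> ?C")
  proof -
    have "g \<in> ?A \<union> ?B \<union> ?C \<longleftrightarrow> gate_inputs g \<subseteq> {..<q}" for g by (cases g) auto
    then show ?thesis by (auto simp: G_def)
  qed
  have "finite G" unfolding G by auto
  have "card G \<le> card (?A \<union> ?B) + card ?C" unfolding G by (rule card_Un_le)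
  also have "\<dots> \<le> (card ?A + card ?B) + card ?C" by (intro add_mono card_Un_le) auto
  also have "\<dots> \<le> (q * q + q * q) + q"
    by (intro add_mono) (rule order_trans[OF card_image_le]; simp)+
  also have "\<dots> \<le> 3 * q\<^sup>2" by (simp add: power2_eq_square)
  finally have cG: "card G \<le> 3 * q\<^sup>2" .
  define \<L> where "\<L> = {gs. set gs \<subseteq> G \<and> length gs \<le> l}"
  have fL: "finite \<L>" unfolding \<L>_def using finite_lists_length_le[OF \<open>finite G\<close>] .
  define dec where "dec = (\<lambda>(gs, out). {i :: nat. i < 2 ^ m \<and> wire_vals m gs (\<lambda>j. odd (i div 2 ^ j)) ! out})"
  have "{S \<in> Pow {..<2 ^ m}. circuit_size_le m (map (\<lambda>i. i \<in> S) [0..<2 ^ m]) l} \<subseteq> dec ` (\<L> \<times> {..<q})"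
  proof safe
    fix S :: "nat set" assume S: "S \<subseteq> {..<2 ^ m}" "circuit_size_le m (map (\<lambda>i. i \<in> S) [0..<2 ^ m]) l"
    then obtain gs out where *: "wf_circuit m gs out" "length gs \<le> l"
      "circuit_computes m gs out (map (\<lambda>i. i \<in> S) [0..<2 ^ m])"
      unfolding circuit_size_le_def by blast
    have "set gs \<subseteq> G"
    proof
      fix g assume "g \<in> set gs"
      then obtain j where "j < length gs" "g = gs ! j" by (auto simp: in_set_conv_nth)
      then show "g \<in> G" using * by (fastforce simp: G_def wf_circuit_def q_def)
    qed
    moreover have "out < q" using * by (auto simp: wf_circuit_def q_def)
    moreover have "S = dec (gs, out)"
      using S(1) *(3) by (auto simp: dec_def circuit_computes_def)
    ultimately show "S \<in> dec ` (\<L> \<times> {..<q})" using *(2) by (auto simp: \<L>_def)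
  qed
  then have "card {S \<in> Pow {..<2 ^ m}. circuit_size_le m (map (\<lambda>i. i \<in> S) [0..<2 ^ m]) l}
      \<le> card (dec ` (\<L> \<times> {..<q}))"
    using fL by (intro card_mono) auto
  also have "\<dots> \<le> card (\<L> \<times> {..<q})" using fL by (intro card_image_le) auto
  also have "\<dots> = card \<L> * q" by (simp add: card_cartesian_product)
  also have "\<dots> \<le> (card G + 1) ^ l * q"
    unfolding \<L>_def using card_lists_length_le_bound[OF \<open>finite G\<close>] by (intro mult_right_mono) auto
  also have "\<dots> \<le> (3 * q\<^sup>2 + 1) ^ l * q"
    using cG by (intro mult_right_mono power_mono) auto
  finally show ?thesis by (simp add: q_def)
qed

section \<open>Hitting sets from affine hashes\<close>

text \<open>The two counting hypotheses are pairwise independence of a random hash. With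
  \<open>k\<close> independent hashes, u = |T| / 2^k elements of \<open>T\<close> survive on
  average, and the choice of \<open>k\<close> puts u between 1/4 and 1/2. The first two moments then
  force an odd number of survivors with probability at least 1/8.\<close>

lemma valiant_vazirani:
  fixes ev :: "'h \<Rightarrow> 'i \<Rightarrow> bool"
  assumes "finite T" "finite H"
    and one: "\<And>i. i \<in> T \<Longrightarrow> 2 * card {h\<in>H. ev h i} = card H"
    and two: "\<And>i i'. i \<in> T \<Longrightarrow> i' \<in> T \<Longrightarrow> i \<noteq> i' \<Longrightarrow> 4 * card {h\<in>H. ev h i \<and> ev h i'} = card H"
    and k: "2 * card T \<le> 2 ^ k" "2 ^ k \<le> 4 * card T"
  shows "card {hs. set hs \<subseteq> H \<and> length hs = k}
     \<le> 8 * card {hs. (set hs \<subseteq> H \<and> length hs = k) \<and> odd (card {i\<in>T. \<forall>h\<in>set hs. ev h i})}"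
proof -
  define Q where "Q = {hs. set hs \<subseteq> H \<and> length hs = k}"
  define M where "M = real (card H)"
  define t where "t = real (card T)"
  define a where "a hs i = (if \<forall>h\<in>set hs. ev h i then 1 else 0 :: real)" for hs i
  define c where "c hs = card {i\<in>T. \<forall>h\<in>set hs. ev h i}" for hs
  have fQ: "finite Q" unfolding Q_def using finite_lists_length_eq[OF \<open>finite H\<close>] .
  have c: "real (c hs) = (\<Sum>i\<in>T. a hs i)" for hs
    unfolding c_def a_def using \<open>finite T\<close> by (simp add: sum.If_cases Int_def)
  have count: "(\<Sum>hs\<in>Q. if \<forall>h\<in>set hs. P h then 1 else 0) = real (card {h\<in>H. P h}) ^ k" for P
  proof -
    have "Q \<inter> {hs. \<forall>h\<in>set hs. P h} = {hs. set hs \<subseteq> {h\<in>H. P h} \<and> length hs = k}"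
      by (auto simp: Q_def)
    then show ?thesis using fQ card_lists_length_eq[of "{h\<in>H. P h}" k] \<open>finite H\<close>
      by (simp add: sum.If_cases)
  qed
  have s1: "(\<Sum>hs\<in>Q. a hs i) = (M / 2) ^ k" if "i \<in> T" for i
  proof -
    have "real (card {h\<in>H. ev h i}) = M / 2" using one[OF that] unfolding M_def by linarith
    then show ?thesis unfolding a_def count by (simp only:)
  qed
  have s2: "(\<Sum>hs\<in>Q. a hs i * a hs i') = (M / 4) ^ k" if "i \<in> T" "i' \<in> T" "i \<noteq> i'" for i i'
  proof -
    have "real (card {h\<in>H. ev h i \<and> ev h i'}) = M / 4" using two[OF that] unfolding M_def by linarith
    moreover have "a hs i * a hs i' = (if \<forall>h\<in>set hs. ev h i \<and> ev h i' then 1 else 0)" for hs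
      by (auto simp: a_def)
    ultimately show ?thesis using count[of "\<lambda>h. ev h i \<and> ev h i'"] by (simp only:)
  qed
  have S1: "(\<Sum>hs\<in>Q. real (c hs)) = t * (M / 2) ^ k"
    unfolding c by (subst sum.swap) (simp add: s1 t_def)
  have S2: "(\<Sum>hs\<in>Q. (real (c hs))\<^sup>2) = t * ((M / 2) ^ k + (t - 1) * (M / 4) ^ k)"
  proof -
    have "(\<Sum>hs\<in>Q. (real (c hs))\<^sup>2) = (\<Sum>hs\<in>Q. \<Sum>i\<in>T. \<Sum>i'\<in>T. a hs i * a hs i')"
      unfolding c power2_eq_square sum_product ..
    also have "\<dots> = (\<Sum>i\<in>T. \<Sum>i'\<in>T. \<Sum>hs\<in>Q. a hs i * a hs i')"
      by (subst sum.swap) (intro sum.cong refl sum.swap)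
    also have "\<dots> = (\<Sum>i\<in>T. (M / 2) ^ k + (t - 1) * (M / 4) ^ k)"
    proof (rule sum.cong[OF refl])
      fix i assume i: "i \<in> T"
      have "(\<Sum>i'\<in>T. \<Sum>hs\<in>Q. a hs i * a hs i')
          = (\<Sum>hs\<in>Q. a hs i * a hs i) + (\<Sum>i'\<in>T - {i}. \<Sum>hs\<in>Q. a hs i * a hs i')"
        using i \<open>finite T\<close> by (rule sum.remove[rotated])
      also have "(\<Sum>hs\<in>Q. a hs i * a hs i) = (\<Sum>hs\<in>Q. a hs i)"
        by (intro sum.cong) (auto simp: a_def)
      also have "(\<Sum>i'\<in>T - {i}. \<Sum>hs\<in>Q. a hs i * a hs i') = (\<Sum>i'\<in>T - {i}. (M / 4) ^ k)"
        using i by (intro sum.cong refl s2) auto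
      also have "\<dots> = (t - 1) * (M / 4) ^ k"
        using i \<open>finite T\<close> card_gt_0_iff[of T] by (auto simp: t_def of_nat_diff Suc_leI)
      finally show "(\<Sum>i'\<in>T. \<Sum>hs\<in>Q. a hs i * a hs i') = (M / 2) ^ k + (t - 1) * (M / 4) ^ k"
        using s1[OF i] by simp
    qed
    finally show ?thesis by (simp add: t_def)
  qed
  \<comment> \<open>A Bonferroni-type bound that needs only the first two moments of \<open>c\<close>.\<close>
  have "2 * real x - (real x)\<^sup>2 \<le> (if odd x then 1 else 0)" for x :: nat
  proof (cases "x = 0 \<or> x = 1")
    case False
    then have "real x * (2 - real x) \<le> 0" by (intro mult_nonneg_nonpos) auto
    then show ?thesis by (simp add: power2_eq_square algebra_simps)
  qed auto
  then have "(\<Sum>hs\<in>Q. 2 * real (c hs) - (real (c hs))\<^sup>2) \<le> (\<Sum>hs\<in>Q. if odd (c hs) then 1 else 0)"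
    by (intro sum_mono) auto
  also have "\<dots> = real (card {hs\<in>Q. odd (c hs)})"
    using fQ by (simp add: sum.If_cases Int_def)
  also have "(\<Sum>hs\<in>Q. 2 * real (c hs) - (real (c hs))\<^sup>2) = t * (M / 2) ^ k - t * (t - 1) * (M / 4) ^ k"
    unfolding sum_subtractf sum_distrib_left[symmetric] S1 S2 by (simp add: algebra_simps)
  also have "\<dots> = M ^ k * (t / 2 ^ k - (t / 2 ^ k)\<^sup>2 + t / 2 ^ k / 2 ^ k)"
  proof -
    have "(4::real) ^ k = 2 ^ k * 2 ^ k" by (simp add: power_mult_distrib[symmetric])
    then have "(M / 2) ^ k = M ^ k / 2 ^ k" "(M / 4) ^ k = M ^ k / (2 ^ k * 2 ^ k)"
      by (simp_all only: power_divide)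
    then show ?thesis by (simp add: power2_eq_square algebra_simps diff_divide_distrib)
  qed
  finally have *: "M ^ k * (t / 2 ^ k - (t / 2 ^ k)\<^sup>2 + t / 2 ^ k / 2 ^ k) \<le> real (card {hs\<in>Q. odd (c hs)})" .
  define u where "u = t / 2 ^ k"
  have "u \<le> 1/2" "u \<ge> 1/4"
    using of_nat_mono[OF k(1), where 'a=real] of_nat_mono[OF k(2), where 'a=real]
    by (simp_all add: u_def t_def field_simps)
  \<comment> \<open>Expanding gives u - u^2 >= 1/8 + u/4.\<close>
  then have "(u - 1/4) * (1/2 - u) \<ge> 0" by simp
  then have "u - u\<^sup>2 \<ge> 1/8" using \<open>u \<ge> 1/4\<close> by (simp add: power2_eq_square algebra_simps)
  moreover have "t / 2 ^ k / 2 ^ k \<ge> 0" by (simp add: t_def)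
  ultimately have "M ^ k * (1/8) \<le> M ^ k * (t / 2 ^ k - (t / 2 ^ k)\<^sup>2 + t / 2 ^ k / 2 ^ k)"
    unfolding u_def by (intro mult_left_mono) (linarith, simp add: M_def)
  then have "M ^ k \<le> 8 * real (card {hs\<in>Q. odd (c hs)})" using * by linarith
  moreover have "real (card Q) = M ^ k"
    unfolding Q_def M_def card_lists_length_eq[OF \<open>finite H\<close>] by simp
  ultimately have "card Q \<le> 8 * card {hs\<in>Q. odd (c hs)}" by linarith
  then show ?thesis unfolding c_def Q_def by simp
qed

text \<open>Every set is hit by an eighth of \<open>\<Phi>\<close>, so by double counting some
  member of \<open>\<Phi>\<close> hits at least an eighth of the sets still unhit. Choosing such a
  member \<open>R\<close> times gives the factor.\<close>

lemma greedy_hitting: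
  assumes "finite \<Phi>" "\<Phi> \<noteq> {}" "finite \<T>"
    and hit: "\<And>T. T \<in> \<T> \<Longrightarrow> card \<Phi> \<le> 8 * card {\<phi>\<in>\<Phi>. hit \<phi> T}"
  shows "\<exists>\<phi>s. length \<phi>s = R \<and> set \<phi>s \<subseteq> \<Phi> \<and>
     real (card {T\<in>\<T>. \<forall>\<phi>\<in>set \<phi>s. \<not> hit \<phi> T}) \<le> (7/8) ^ R * real (card \<T>)"
proof (induction R)
  case (Suc R)
  then obtain \<phi>s where IH: "length \<phi>s = R" "set \<phi>s \<subseteq> \<Phi>"
    "real (card {T\<in>\<T>. \<forall>\<phi>\<in>set \<phi>s. \<not> hit \<phi> T}) \<le> (7/8) ^ R * real (card \<T>)" by blast
  define U where "U = {T\<in>\<T>. \<forall>\<phi>\<in>set \<phi>s. \<not> hit \<phi> T}"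
  have fU: "finite U" unfolding U_def using assms by simp
  have "\<exists>\<phi>\<in>\<Phi>. real (card {T\<in>U. \<not> hit \<phi> T}) \<le> 7/8 * real (card U)"
  proof (rule ccontr)
    assume "\<not> ?thesis"
    then have "(\<Sum>\<phi>\<in>\<Phi>. 7/8 * real (card U)) < (\<Sum>\<phi>\<in>\<Phi>. real (card {T\<in>U. \<not> hit \<phi> T}))"
      using assms by (intro sum_strict_mono) auto
    also have "\<dots> = (\<Sum>\<phi>\<in>\<Phi>. \<Sum>T\<in>U. if \<not> hit \<phi> T then 1 else 0)"
      using fU by (simp add: sum.If_cases Int_def)
    also have "\<dots> = (\<Sum>T\<in>U. \<Sum>\<phi>\<in>\<Phi>. if \<not> hit \<phi> T then 1 else 0)"
      by (rule sum.swap)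
    also have "\<dots> \<le> (\<Sum>T\<in>U. 7/8 * real (card \<Phi>))"
    proof (rule sum_mono)
      fix T assume "T \<in> U"
      have "(\<Sum>\<phi>\<in>\<Phi>. if \<not> hit \<phi> T then 1 else 0) = real (card (\<Phi> - {\<phi>\<in>\<Phi>. hit \<phi> T}))"
        using assms(1) by (simp add: sum.If_cases set_diff_eq Int_def conj_commute) (metis (no_types, lifting))
      also have "\<dots> = real (card \<Phi>) - real (card {\<phi>\<in>\<Phi>. hit \<phi> T})"
        using assms(1) by (subst card_Diff_subset) (auto simp: of_nat_diff card_mono)
      also have "\<dots> \<le> 7/8 * real (card \<Phi>)"
        using hit[of T] \<open>T \<in> U\<close> by (simp add: U_def)
      finally show "(\<Sum>\<phi>\<in>\<Phi>. if \<not> hit \<phi> T then 1 else 0) \<le> 7/8 * real (card \<Phi>)" .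
    qed
    finally show False by (simp add: mult_ac)
  qed
  then obtain \<phi> where \<phi>: "\<phi> \<in> \<Phi>" "real (card {T\<in>U. \<not> hit \<phi> T}) \<le> 7/8 * real (card U)" by blast
  have "{T\<in>U. \<not> hit \<phi> T} = {T\<in>\<T>. \<forall>\<phi>\<in>set (\<phi> # \<phi>s). \<not> hit \<phi> T}"
    by (auto simp: U_def)
  then have "real (card {T\<in>\<T>. \<forall>\<phi>\<in>set (\<phi> # \<phi>s). \<not> hit \<phi> T}) \<le> (7/8) ^ Suc R * real (card \<T>)"
    using \<phi>(2) IH(3) by (simp add: U_def)
  then show ?case using IH \<phi> by (intro exI[of _ "\<phi> # \<phi>s"]) auto
qed (use assms in auto)

section \<open>Affine forms over GF(2) as pairwise independent hashes\<close>

definition affine :: "nat set \<times> bool \<Rightarrow> (nat \<Rightarrow> bool) \<Rightarrow> bool" where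
  "affine h a \<longleftrightarrow> (snd h \<noteq> odd (card {j \<in> fst h. a j}))"

abbreviation bits :: "nat \<Rightarrow> nat \<Rightarrow> bool" where
  "bits i \<equiv> (\<lambda>j. odd (i div 2 ^ j))"

text \<open>For each linear part exactly one constant makes the form true at
  \<open>a\<close>.\<close>

lemma card_affine_one:
  fixes m :: nat
  shows "2 * card {h \<in> Pow {..<m} \<times> UNIV. affine h a} = card (Pow {..<m} \<times> (UNIV :: bool set))"
proof -
  have "{h \<in> Pow {..<m} \<times> UNIV. affine h a} = (\<lambda>A. (A, even (card {j\<in>A. a j}))) ` Pow {..<m}"
    by (auto simp: affine_def image_iff)
  moreover have "inj_on (\<lambda>A. (A, even (card {j\<in>A. a j}))) (Pow {..<m})"
    by (auto intro: inj_onI)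
  ultimately have "card {h \<in> Pow {..<m} \<times> UNIV. affine h a} = 2 ^ m"
    by (simp add: card_image card_Pow)
  then show ?thesis by (simp add: card_cartesian_product card_Pow)
qed

lemma card_affine_two:
  fixes m :: nat
  assumes "d < m" "a d \<noteq> b d"
  shows "4 * card {h \<in> Pow {..<m} \<times> UNIV. affine h a \<and> affine h b} = card (Pow {..<m} \<times> (UNIV :: bool set))"
proof -
  let ?H = "Pow {..<m} \<times> (UNIV :: bool set)"
  let ?P = "{h \<in> ?H. affine h a \<and> affine h b}" and ?N = "{h \<in> ?H. affine h a \<and> \<not> affine h b}"
  \<comment> \<open>Toggling the position \<open>d\<close> in the linear part, with the constant adjusted to keep
    the value at \<open>a\<close>, changes the value at \<open>b\<close>.\<close>
  define \<sigma> where "\<sigma> = (\<lambda>(A, c). (if d \<in> A then A - {d} else insert d A, c \<noteq> a d))"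
  have \<sigma>\<sigma>: "\<sigma> (\<sigma> h) = h" for h by (cases h) (auto simp: \<sigma>_def)
  have \<sigma>H: "\<sigma> h \<in> ?H" if "h \<in> ?H" for h
    using that assms by (cases h) (auto simp: \<sigma>_def)
  have toggle: "affine (\<sigma> h) x \<longleftrightarrow> (affine h x \<noteq> (x d \<noteq> a d))" if hH: "h \<in> ?H" for h x
  proof -
    obtain A c where h: "h = (A, c)" "A \<subseteq> {..<m}"
      using hH by (cases h) auto
    then have "finite A" using finite_subset by blast
    note h = h(1) this
    show ?thesis
    proof (cases "d \<in> A")
      case True
      then have "odd (card {j\<in>A. x j}) = (x d \<noteq> odd (card {j \<in> A - {d}. x j}))"
        using odd_card_insert[of "A - {d}" d x] h by (simp add: insert_absorb)
      then show ?thesis using True by (auto simp: h affine_def \<sigma>_def)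
    next
      case False
      then show ?thesis using odd_card_insert[of A d x] h by (auto simp: affine_def \<sigma>_def)
    qed
  qed
  have "bij_betw \<sigma> ?P ?N"
  proof (rule bij_betw_byWitness[where f' = \<sigma>])
    show "\<sigma> ` ?P \<subseteq> ?N" "\<sigma> ` ?N \<subseteq> ?P"
      unfolding image_subset_iff mem_Collect_eq using \<sigma>H toggle assms(2) by blast+
  qed (use \<sigma>\<sigma> in blast)+
  then have "card ?P = card ?N" by (rule bij_betw_same_card)
  moreover have "card ?P + card ?N = card {h \<in> ?H. affine h a}"
    by (subst card_Un_disjoint[symmetric]) (auto intro: arg_cong[where f = card])
  ultimately show ?thesis using card_affine_one[of m a] by simp
qed

lemma bits_neq:
  fixes i i' m :: nat
  assumes "i < 2 ^ m" "i' < 2 ^ m" "i \<noteq> i'"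
  shows "\<exists>d<m. bits i d \<noteq> bits i' d"
proof (rule ccontr)
  assume "\<not> ?thesis"
  then have "bit i d = bit i' d" if "d < m" for d
    using that by (auto simp: bit_iff_odd)
  then have "take_bit m i = take_bit m i'"
    by (intro bit_eqI) (auto simp: bit_take_bit_iff)
  then show False using assms by (simp add: take_bit_nat_eq_self)
qed

text \<open>The right number \<open>k\<close> of hashes depends on the size of \<open>T\<close>, so
  the sets are grouped by scale. Each of the m+2 scales gets \<open>R\<close> hash lists by the
  greedy argument, and all the lists are concatenated.\<close>

lemma hitting_hashes:
  fixes \<T> :: "nat set set"
  assumes "\<And>T. T \<in> \<T> \<Longrightarrow> T \<subseteq> {..<2 ^ m} \<and> T \<noteq> {}"
    and "finite \<T>" "(7/8) ^ R * real (card \<T>) < 1"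
  shows "\<exists>\<psi>s. length \<psi>s = (m + 2) * R \<and>
     (\<forall>\<psi>\<in>set \<psi>s. length \<psi> \<le> m + 1 \<and> set \<psi> \<subseteq> Pow {..<m} \<times> UNIV) \<and>
     (\<forall>T\<in>\<T>. \<exists>\<psi>\<in>set \<psi>s. odd (card {i\<in>T. \<forall>h\<in>set \<psi>. affine h (bits i)}))"
proof -
  let ?H = "Pow {..<m} \<times> (UNIV :: bool set)"
  define hit where "hit \<psi> T = odd (card {i\<in>T. \<forall>h\<in>set \<psi>. affine h (bits i)})"
    for \<psi> :: "(nat set \<times> bool) list" and T :: "nat set"
  define \<T>k where "\<T>k k = {T\<in>\<T>. 2 * card T \<le> 2 ^ k \<and> 2 ^ k \<le> 4 * card T}" for k :: nat
  define \<Phi> where "\<Phi> k = {\<psi>. set \<psi> \<subseteq> ?H \<and> length \<psi> = k}" for k :: nat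
  have "\<exists>\<psi>s. length \<psi>s = R \<and> set \<psi>s \<subseteq> \<Phi> k \<and> (\<forall>T\<in>\<T>k k. \<exists>\<psi>\<in>set \<psi>s. hit \<psi> T)" for k
  proof -
    have f: "finite (\<T>k k)" using assms by (simp add: \<T>k_def)
    have f\<Phi>: "finite (\<Phi> k)" unfolding \<Phi>_def by (intro finite_lists_length_eq) auto
    have "replicate k ({}, True) \<in> \<Phi> k" by (auto simp: \<Phi>_def)
    then have ne: "\<Phi> k \<noteq> {}" by blast
    have "card (\<Phi> k) \<le> 8 * card {\<psi>\<in>\<Phi> k. hit \<psi> T}" if "T \<in> \<T>k k" for T
    proof -
      have T: "T \<subseteq> {..<2 ^ m}" "2 * card T \<le> 2 ^ k" "2 ^ k \<le> 4 * card T"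
        using that assms(1) by (auto simp: \<T>k_def)
      show ?thesis unfolding \<Phi>_def hit_def mem_Collect_eq
      proof (rule valiant_vazirani)
        show "finite T" using T(1) finite_subset by blast
        fix i i' assume "i \<in> T" "i' \<in> T" "i \<noteq> i'"
        then obtain d where "d < m" "bits i d \<noteq> bits i' d"
          using bits_neq[of i m i'] T(1) by auto
        then show "4 * card {h\<in>?H. affine h (bits i) \<and> affine h (bits i')} = card ?H"
          by (rule card_affine_two)
      qed (use T card_affine_one in auto)
    qed
    from greedy_hitting[where R = R and hit = hit, OF f\<Phi> ne f this]
    obtain \<psi>s where \<psi>s: "length \<psi>s = R" "set \<psi>s \<subseteq> \<Phi> k"
      "real (card {T\<in>\<T>k k. \<forall>\<phi>\<in>set \<psi>s. \<not> hit \<phi> T}) \<le> (7/8) ^ R * real (card (\<T>k k))" by blast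
    note \<psi>s(3)
    also have "(7/8) ^ R * real (card (\<T>k k)) \<le> (7/8) ^ R * real (card \<T>)"
      using assms(2) by (intro mult_left_mono) (auto simp: \<T>k_def intro!: card_mono)
    also have "\<dots> < 1" by fact
    \<comment> \<open>A cardinality below 1 is 0, so every set of this scale is hit.\<close>
    finally have "card {T\<in>\<T>k k. \<forall>\<phi>\<in>set \<psi>s. \<not> hit \<phi> T} = 0" by simp
    then have "{T\<in>\<T>k k. \<forall>\<phi>\<in>set \<psi>s. \<not> hit \<phi> T} = {}" using f by simp
    then show ?thesis using \<psi>s by blast
  qed
  then obtain \<Psi> where \<Psi>: "\<And>k. length (\<Psi> k) = R" "\<And>k. set (\<Psi> k) \<subseteq> \<Phi> k"
    "\<And>k T. T \<in> \<T>k k \<Longrightarrow> \<exists>\<psi>\<in>set (\<Psi> k). hit \<psi> T" by metis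
  define \<psi>s where "\<psi>s = concat (map \<Psi> [0..<m + 2])"
  have "length \<psi>s = (m + 2) * R"
    by (simp add: \<psi>s_def length_concat o_def \<Psi>(1) sum_list_triv)
  moreover have "length \<psi> \<le> m + 1 \<and> set \<psi> \<subseteq> ?H" if "\<psi> \<in> set \<psi>s" for \<psi>
    using that \<Psi>(2) by (fastforce simp: \<psi>s_def \<Phi>_def)
  moreover have "\<exists>\<psi>\<in>set \<psi>s. hit \<psi> T" if "T \<in> \<T>" for T
  proof -
    have T: "T \<subseteq> {..<2 ^ m}" "T \<noteq> {}" "finite T" using assms(1)[OF that] finite_subset by auto
    have "card T \<le> 2 ^ m" using card_mono[OF _ T(1)] by simp
    then have m1: "2 * card T \<le> 2 ^ (m + 1)" by simp
    \<comment> \<open>Minimality gives 2^k < 4 |T|, because k-1 fails; the bound |T| <= 2^m keeps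
      \<open>k\<close> among the scales provided.\<close>
    define k where "k = (LEAST k. 2 * card T \<le> 2 ^ k)"
    have k: "2 * card T \<le> 2 ^ k" "k \<le> m + 1"
      unfolding k_def using m1 by (rule LeastI, intro Least_le)
    have "card T \<ge> 1" using T by (simp add: Suc_leI card_gt_0_iff)
    then have "k \<noteq> 0" using k(1) by (cases k) auto
    then obtain k' where k': "k = Suc k'" by (cases k) auto
    then have "\<not> 2 * card T \<le> 2 ^ k'"
      using not_less_Least[of k' "\<lambda>k. 2 * card T \<le> 2 ^ k"] by (simp add: k_def)
    then have "T \<in> \<T>k k" using k k' that by (simp add: \<T>k_def)
    then obtain \<psi> where "\<psi> \<in> set (\<Psi> k)" "hit \<psi> T" using \<Psi>(3) by blast
    moreover have "k \<in> set [0..<m + 2]" using k(2) by auto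
    ultimately show ?thesis unfolding \<psi>s_def set_concat set_map by blast
  qed
  ultimately show ?thesis unfolding hit_def by blast
qed

section \<open>Formulas of parities for MCSP\<close>

lemma sg_simps [simp]: "sg b * sg b = 1" "\<bar>sg b\<bar> = 1" "sg False = 1" "sg True = -1"
  "sg (\<not> b) = - sg b"
  by (auto simp: sg_def)

lemma sg_neq: "sg (a \<noteq> b) = sg a * sg b"
  by (auto simp: sg_def)

lemma sg_odd_card:
  assumes "finite A"
  shows "sg (odd (card {i\<in>A. P i})) = (\<Prod>i\<in>A. sg (P i))"
  using assms
proof (induction A)
  case (insert x A)
  show ?case
    unfolding odd_card_insert[OF insert.hyps(1,2)] sg_neq prod.insert[OF insert.hyps(1,2)] insert.IH ..
qed simp

lemma prod_symmetric_difference: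
  assumes "finite A" "finite B" "\<And>q. h q * h q = (1::real)"
  shows "(\<Prod>q\<in>A. h q) * (\<Prod>q\<in>B. h q) = (\<Prod>q\<in>(A - B) \<union> (B - A). h q)"
proof -
  have split: "(\<Prod>q\<in>A. h q) = (\<Prod>q\<in>A - B. h q) * (\<Prod>q\<in>A \<inter> B. h q)" if "finite A" for A B
    using prod.Int_Diff[OF that, of h B] by (simp add: mult.commute)
  note A = split[OF assms(1), of B] and B = split[OF assms(2), of A, unfolded Int_commute[of B A]]
  have "(\<Prod>q\<in>A \<inter> B. h q) * (\<Prod>q\<in>A \<inter> B. h q) = 1"
    by (simp add: prod.distrib[symmetric] assms)
  then have "(\<Prod>q\<in>A. h q) * (\<Prod>q\<in>B. h q) = (\<Prod>q\<in>A - B. h q) * (\<Prod>q\<in>B - A. h q)"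
    unfolding A B by (metis (no_types, lifting) mult.assoc mult.commute mult.right_neutral)
  also have "\<dots> = (\<Prod>q\<in>(A - B) \<union> (B - A). h q)"
    using assms by (intro prod.union_disjoint[symmetric]) auto
  finally show ?thesis .
qed

text \<open>Toggling a fixed element of \<open>T\<close> is an involution on the subsets of
  \<open>U\<close> that flips the sign of the character.\<close>

lemma sum_character_eq_0:
  assumes "finite U" "T \<subseteq> U" "T \<noteq> {}"
  shows "(\<Sum>S\<in>Pow U. \<Prod>q\<in>T. sg (q \<in> S)) = 0"
proof -
  obtain a where a: "a \<in> T" using assms by blast
  have fT: "finite T" using assms finite_subset by blast
  define \<sigma> where "\<sigma> S = (if a \<in> S then S - {a} else insert a S)" for S
  let ?f = "\<lambda>S. \<Prod>q\<in>T. sg (q \<in> S)"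
  have "(\<Sum>S\<in>Pow U. ?f S) = (\<Sum>S\<in>Pow U. ?f (\<sigma> S))"
  proof (rule sum.reindex_bij_witness[of _ \<sigma> \<sigma>])
    show \<sigma>\<sigma>: "\<sigma> (\<sigma> S) = S" for S by (auto simp: \<sigma>_def)
    then show "?f (\<sigma> (\<sigma> S)) = ?f S" for S by simp
  qed (use a assms in \<open>auto simp: \<sigma>_def split: if_splits\<close>)
  also have "?f (\<sigma> S) = - ?f S" for S
  proof -
    have "(\<Prod>q\<in>T - {a}. sg (q \<in> \<sigma> S)) = (\<Prod>q\<in>T - {a}. sg (q \<in> S))"
      by (intro prod.cong) (auto simp: \<sigma>_def)
    moreover have "sg (a \<in> \<sigma> S) = - sg (a \<in> S)" by (auto simp: \<sigma>_def)
    ultimately show ?thesis using a fT by (simp add: prod.remove)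
  qed
  then have "(\<Sum>S\<in>Pow U. ?f (\<sigma> S)) = - (\<Sum>S\<in>Pow U. ?f S)" by (simp add: sum_negf)
  finally show ?thesis by simp
qed

section \<open>MCSP instances as inputs of parities\<close>

definition instance_of :: "nat \<Rightarrow> nat \<Rightarrow> nat set \<Rightarrow> bool list" where
  "instance_of n l S = map (\<lambda>i. i \<in> S) [0..<n] @ replicate l True @ replicate (n - l) False"

text \<open>The threshold can be read off its unary code as the number of ones, so the existential
  in \<open>mcsp\<close> has only one candidate.\<close>

lemma mcsp_instance_of:
  assumes "l \<le> 2 ^ m"
  shows "mcsp m (instance_of (2 ^ m) l S) \<longleftrightarrow> circuit_size_le m (map (\<lambda>i. i \<in> S) [0..<2 ^ m]) l"
proof -
  have "l' = l" if "replicate l True @ replicate (2 ^ m - l) False = replicate l' True @ replicate (2 ^ m - l') False" for l'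
    using arg_cong[OF that, of "\<lambda>xs. length (filter id xs)"] by simp
  then show ?thesis using assms by (auto simp: mcsp_def instance_of_def)
qed

text \<open>With the threshold fixed, the second half of the input contributes only a constant sign
  to each parity, which thus becomes a character of the table. A product of characters is the
  character of the symmetric difference.\<close>

lemma parity_product_character:
  assumes "\<And>i. i \<in> set L \<Longrightarrow> fst (g i) \<subseteq> {..<2 * n}"
  shows "\<exists>C T. T \<subseteq> {..<n} \<and>
     (\<forall>S. (\<Prod>i\<leftarrow>L. sg (parity_fn (g i) (instance_of n l S))) = C * (\<Prod>q\<in>T. sg (q \<in> S)))"
  using assms
proof (induction L)
  case Nil
  show ?case by (intro exI[of _ 1] exI[of _ "{}"]) auto
next
  case (Cons i L)
  then obtain C T where CT: "T \<subseteq> {..<n}"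
    "\<And>S. (\<Prod>i\<leftarrow>L. sg (parity_fn (g i) (instance_of n l S))) = C * (\<Prod>q\<in>T. sg (q \<in> S))" by auto
  define A where "A = fst (g i) \<inter> {..<n}"
  define B where "B = fst (g i) - {..<n}"
  define D where "D = sg (snd (g i)) * (\<Prod>q\<in>B. sg ((replicate l True @ replicate (n - l) False) ! (q - n)))"
  have fin: "finite A" "finite B" "finite T"
    using Cons.prems[of i] CT(1) by (auto simp: A_def B_def intro: finite_subset)
  have *: "sg (parity_fn (g i) (instance_of n l S)) = D * (\<Prod>q\<in>A. sg (q \<in> S))" for S
  proof -
    have "sg (parity_fn (g i) (instance_of n l S))
        = sg (snd (g i)) * (\<Prod>q\<in>A \<union> B. sg (instance_of n l S ! q))"
    proof -
      have AB: "fst (g i) = A \<union> B" by (auto simp: A_def B_def)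
      have "finite (A \<union> B)" using fin by simp
      then show ?thesis unfolding parity_fn_def sg_neq AB by (simp only: sg_odd_card)
    qed
    also have "(\<Prod>q\<in>A \<union> B. sg (instance_of n l S ! q))
       = (\<Prod>q\<in>A. sg (instance_of n l S ! q)) * (\<Prod>q\<in>B. sg (instance_of n l S ! q))"
      using fin by (intro prod.union_disjoint) (auto simp: A_def B_def)
    also have "(\<Prod>q\<in>A. sg (instance_of n l S ! q)) = (\<Prod>q\<in>A. sg (q \<in> S))"
      by (intro prod.cong) (auto simp: A_def instance_of_def nth_append)
    also have "(\<Prod>q\<in>B. sg (instance_of n l S ! q))
       = (\<Prod>q\<in>B. sg ((replicate l True @ replicate (n - l) False) ! (q - n)))"
    proof (intro prod.cong refl)
      fix q assume "q \<in> B"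
      then have "\<not> q < n" by (auto simp: B_def)
      then show "sg (instance_of n l S ! q) = sg ((replicate l True @ replicate (n - l) False) ! (q - n))"
        unfolding instance_of_def by (subst nth_append) simp
    qed
    finally show ?thesis by (simp add: D_def mult_ac)
  qed
  have "(\<Prod>i\<leftarrow>i # L. sg (parity_fn (g i) (instance_of n l S)))
      = (D * C) * (\<Prod>q\<in>(A - T) \<union> (T - A). sg (q \<in> S))" for S
    using prod_symmetric_difference[OF fin(1,3), of "\<lambda>q. sg (q \<in> S)"]
    by (simp add: * CT(2) mult_ac)
  moreover have "(A - T) \<union> (T - A) \<subseteq> {..<n}" using CT(1) by (auto simp: A_def)
  ultimately show ?case by blast
qed

text \<open>Exchanging the two products turns a character of the table generated by \<open>b\<close>
  into a character of the selection \<open>b\<close>; it is nontrivial once some hash meets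
  \<open>T\<close> in an odd number of points.\<close>

lemma generated_character:
  assumes "finite T" "finite b"
  shows "(\<Prod>q\<in>T. sg (odd (card {j\<in>b. P j q}))) = (\<Prod>j\<in>b. sg (odd (card {q\<in>T. P j q})))"
  unfolding sg_odd_card[OF assms(1)] sg_odd_card[OF assms(2)] by (rule prod.swap)

text \<open>This isolates the argument from the arithmetic: \<open>R\<close> lets the hashes hit
  every character that arises, \<open>upper\<close> makes all generated tables easy, and
  \<open>lower\<close> makes at most a quarter of all tables easy.\<close>

lemma mcsp_formula_contradiction:
  fixes m s \<tau> R l :: nat
  assumes formula: "in_formula_xor (2 * 2 ^ m) s (mcsp m)"
    and m: "m > 0" and l: "l \<le> 2 ^ m"
    and \<tau>: "real \<tau> \<ge> 4 * sqrt (1 + 16 * real s)"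
    and R: "(7/8) ^ R * (real s + 1) ^ \<tau> < 1"
    and upper: "2 + (m + 2) * R * (3 + (m + 1) * (4 * m + 8) + 4) \<le> l"
    and lower: "4 * ((3 * (m + l)\<^sup>2 + 1) ^ l * (m + l)) \<le> 2 ^ 2 ^ m"
  shows False
proof -
  define n :: nat where "n = 2 ^ m"
  obtain F g where F: "fsize F \<le> s" "fleaves F \<subseteq> {..<s}" "\<And>i. i < s \<Longrightarrow> fst (g i) \<subseteq> {..<2 * n}"
    and comp: "\<And>x. length x = 2 * n \<Longrightarrow> feval (\<lambda>i. parity_fn (g i) x) F = mcsp m x"
    using formula unfolding in_formula_xor_def n_def by blast
  have len: "length (instance_of n l S) = 2 * n" for S
    using l by (simp add: instance_of_def n_def)
  have feval_iff: "feval (\<lambda>i. parity_fn (g i) (instance_of n l S)) F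
      \<longleftrightarrow> circuit_size_le m (map (\<lambda>i. i \<in> S) [0..<n]) l" for S
    using comp[OF len] mcsp_instance_of[OF l] by (simp add: n_def)
  define \<L> where "\<L> = {L. set L \<subseteq> {..<s} \<and> length L \<le> \<tau>}"
  have fL: "finite \<L>" unfolding \<L>_def by (intro finite_lists_length_le) simp
  have "\<forall>L\<in>\<L>. \<exists>C T. T \<subseteq> {..<n} \<and>
     (\<forall>S. (\<Prod>i\<leftarrow>L. sg (parity_fn (g i) (instance_of n l S))) = C * (\<Prod>q\<in>T. sg (q \<in> S)))"
    using F(3) by (intro ballI parity_product_character) (auto simp: \<L>_def)
  then obtain C T where CT: "\<And>L. L \<in> \<L> \<Longrightarrow> T L \<subseteq> {..<n}"
    "\<And>L S. L \<in> \<L> \<Longrightarrow> (\<Prod>i\<leftarrow>L. sg (parity_fn (g i) (instance_of n l S))) = C L * (\<Prod>q\<in>T L. sg (q \<in> S))"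
    by metis
  \<comment> \<open>The empty set is excluded because no hash hits it; the empty character has
    average 1 under both distributions anyway.\<close>
  define \<T> where "\<T> = T ` \<L> - {{}}"
  have "card \<T> \<le> card (T ` \<L>)" unfolding \<T>_def using fL by (intro card_mono) auto
  also have "\<dots> \<le> card \<L>" using fL by (rule card_image_le)
  also have "\<dots> \<le> (s + 1) ^ \<tau>" unfolding \<L>_def using card_lists_length_le_bound[of "{..<s}" \<tau>] by simp
  finally have "real (card \<T>) \<le> real ((s + 1) ^ \<tau>)" by (rule of_nat_mono)
  then have "(7/8) ^ R * real (card \<T>) \<le> (7/8) ^ R * (real s + 1) ^ \<tau>"
    by (intro mult_left_mono) (auto simp: add.commute)
  then have small: "(7/8) ^ R * real (card \<T>) < 1" using R by linarith
  have sub: "T' \<subseteq> {..<2 ^ m} \<and> T' \<noteq> {}" if "T' \<in> \<T>" for T'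
    using that CT(1) by (auto simp: \<T>_def n_def)
  have "finite \<T>" using fL by (simp add: \<T>_def)
  from hitting_hashes[OF sub this small] obtain \<psi>s where \<psi>s: "length \<psi>s = (m + 2) * R"
     "\<And>\<psi>. \<psi> \<in> set \<psi>s \<Longrightarrow> length \<psi> \<le> m + 1 \<and> set \<psi> \<subseteq> Pow {..<m} \<times> UNIV"
     "\<And>T. T \<in> \<T> \<Longrightarrow> \<exists>\<psi>\<in>set \<psi>s. odd (card {i\<in>T. \<forall>h\<in>set \<psi>. affine h (bits i)})"
    by blast
  define r where "r = (m + 2) * R"
  define \<phi> where "\<phi> j a = (\<forall>h\<in>set (\<psi>s ! j). affine h a)" for j a
  \<comment> \<open>The sum mod 2 of the hashes selected by the seed \<open>b\<close>, as the set of
    ones of its table.\<close>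
  define gen where "gen b = {i\<in>{..<n}. odd (card {j\<in>b. \<phi> j (bits i)})}" for b
  have ckt_affine: "ckt m (4 * m + 6) (affine h)" if "h \<in> Pow {..<m} \<times> UNIV" for h
  proof -
    obtain A c where h: "h = (A, c)" by (cases h)
    then have A: "A \<subseteq> {..<m}" using that by simp
    then have "finite A" "card A \<le> m" using finite_subset card_mono[OF _ A] by auto
    have odd: "ckt m (2 + card A * (0 + 4)) (\<lambda>a. odd (card {j\<in>A. a j}))"
      using A by (intro ckt_parity \<open>finite A\<close> m ckt_input) auto
    have "ckt m (2 + card A * 4 + 1) (\<lambda>a. c \<noteq> odd (card {j\<in>A. a j}))"
      using ckt_not[OF odd] ckt_mono[OF odd, of "2 + card A * 4 + 1"] by (cases c) auto
    then have "ckt m (2 + card A * 4 + 1) (affine h)" by (simp add: affine_def[abs_def] h)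
    then show ?thesis by (rule ckt_mono) (use \<open>card A \<le> m\<close> in simp)
  qed
  have ckt_\<phi>: "ckt m (3 + (m + 1) * (4 * m + 8)) (\<phi> j)" if "j < r" for j
  proof -
    have j: "\<psi>s ! j \<in> set \<psi>s" using that \<psi>s(1) by (simp add: r_def)
    have "ckt m (3 + length (\<psi>s ! j) * (4 * m + 6 + 1)) (\<phi> j)"
      unfolding \<phi>_def using \<psi>s(2)[OF j] by (intro ckt_all m ckt_affine) auto
    moreover have "length (\<psi>s ! j) * (4 * m + 6 + 1) \<le> (m + 1) * (4 * m + 8)"
      using \<psi>s(2)[OF j] by (intro mult_mono) auto
    ultimately show ?thesis by (elim ckt_mono) simp
  qed
  have easy: "circuit_size_le m (map (\<lambda>i. i \<in> gen b) [0..<n]) l" if b: "b \<subseteq> {..<r}" for b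
  proof (rule circuit_size_le_ckt)
    have "finite b" "card b \<le> r" using finite_subset[OF b] card_mono[OF _ b] by auto
    show "ckt m (2 + card b * (3 + (m + 1) * (4 * m + 8) + 4)) (\<lambda>a. odd (card {j\<in>b. \<phi> j a}))"
      using b by (intro ckt_parity m \<open>finite b\<close> ckt_\<phi>) auto
    have "card b * (3 + (m + 1) * (4 * m + 8) + 4) \<le> r * (3 + (m + 1) * (4 * m + 8) + 4)"
      using \<open>card b \<le> r\<close> by (rule mult_right_mono) simp
    then show "2 + card b * (3 + (m + 1) * (4 * m + 8) + 4) \<le> l"
      using upper unfolding r_def by linarith
  qed (auto simp: gen_def n_def)
  have gen_char: "(\<Sum>b\<in>Pow {..<r}. \<Prod>q\<in>T'. sg (q \<in> gen b)) = 0" if memT: "T' \<in> \<T>" for T'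
  proof -
    have "T' \<subseteq> {..<n}" using memT CT(1) by (auto simp: \<T>_def)
    then have T': "T' \<subseteq> {..<n}" "finite T'" using finite_subset by auto
    \<comment> \<open>The hashes that meet \<open>T'\<close> in an odd number of points. On
      generated tables the character \<open>T'\<close> equals the character \<open>B\<close> of the
      seed, and \<open>B\<close> is nonempty by the hitting property.\<close>
    define B where "B = {j\<in>{..<r}. odd (card {q\<in>T'. \<phi> j (bits q)})}"
    obtain \<psi> where "\<psi> \<in> set \<psi>s" "odd (card {i\<in>T'. \<forall>h\<in>set \<psi>. affine h (bits i)})"
      using \<psi>s(3)[OF memT] by blast
    then obtain j where "j < r" "odd (card {i\<in>T'. \<phi> j (bits i)})"
      using \<psi>s(1) by (auto simp: in_set_conv_nth r_def \<phi>_def)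
    then have "B \<noteq> {}" by (auto simp: B_def)
    have "(\<Prod>q\<in>T'. sg (q \<in> gen b)) = (\<Prod>j\<in>B. sg (j \<in> b))" if "b \<in> Pow {..<r}" for b
    proof -
      have "finite b" using that finite_subset by auto
      have "(\<Prod>q\<in>T'. sg (q \<in> gen b)) = (\<Prod>q\<in>T'. sg (odd (card {j\<in>b. \<phi> j (bits q)})))"
        using T'(1) by (intro prod.cong) (auto simp: gen_def)
      also have "\<dots> = (\<Prod>j\<in>b. sg (odd (card {q\<in>T'. \<phi> j (bits q)})))"
        by (rule generated_character) fact+
      also have "\<dots> = (\<Prod>j\<in>b. sg (j \<in> B))"
        using that by (intro prod.cong) (auto simp: B_def)
      also have "\<dots> = (\<Prod>j\<in>b \<inter> B. -1)"
        using \<open>finite b\<close> by (subst prod.inter_restrict) (auto intro!: prod.cong)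
      also have "\<dots> = (\<Prod>j\<in>B \<inter> b. -1)" by (simp add: Int_commute)
      also have "\<dots> = (\<Prod>j\<in>B. sg (j \<in> b))"
        by (subst prod.inter_restrict) (auto simp: B_def intro!: prod.cong)
      finally show ?thesis .
    qed
    then have "(\<Sum>b\<in>Pow {..<r}. \<Prod>q\<in>T'. sg (q \<in> gen b)) = (\<Sum>b\<in>Pow {..<r}. \<Prod>j\<in>B. sg (j \<in> b))"
      by (rule sum.cong[OF refl])
    also have "\<dots> = 0" using \<open>B \<noteq> {}\<close> by (intro sum_character_eq_0) (auto simp: B_def)
    finally show ?thesis .
  qed
  \<comment> \<open>A disjoint union of tables and seeds, so that a table generated by several seeds
    is counted with multiplicity. The weight \<open>\<mu>\<close> is the uniform distribution on
    tables minus that on seeds.\<close>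
  define X where "X = Pow {..<n} <+> Pow {..<r}"
  define inst where "inst x = instance_of n l (case x of Inl S \<Rightarrow> S | Inr b \<Rightarrow> gen b)" for x
  define \<mu> :: "nat set + nat set \<Rightarrow> real" where
    "\<mu> x = (case x of Inl _ \<Rightarrow> 1 / 2 ^ n | Inr _ \<Rightarrow> - 1 / 2 ^ r)" for x
  have sumX: "(\<Sum>x\<in>X. \<mu> x * f x)
     = (\<Sum>S\<in>Pow {..<n}. f (Inl S)) / 2 ^ n - (\<Sum>b\<in>Pow {..<r}. f (Inr b)) / 2 ^ r" for f
    unfolding X_def by (subst sum.Plus) (auto simp: \<mu>_def sum_divide_distrib sum_negf)
  have "\<exists>p. (\<forall>x\<in>X. \<bar>p x\<bar> \<le> 1 \<and> (feval (\<lambda>i. parity_fn (g i) (inst x)) F \<longrightarrow> p x \<ge> 3/4) \<and>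
         (\<not> feval (\<lambda>i. parity_fn (g i) (inst x)) F \<longrightarrow> p x \<le> 1/4)) \<and> (\<Sum>x\<in>X. \<mu> x * p x) = 0"
  proof (rule formula_approximation)
    show "finite X" by (simp add: X_def)
    have "sqrt (1 + 16 * real (fsize F)) \<le> sqrt (1 + 16 * real s)" using F(1) by simp
    then show "4 * sqrt (1 + 16 * real (fsize F)) \<le> real \<tau>" using \<tau> by linarith
    fix L assume "set L \<subseteq> fleaves F" "length L < \<tau>"
    then have L: "L \<in> \<L>" using F(2) by (auto simp: \<L>_def)
    have "(\<Sum>x\<in>X. \<mu> x * (\<Prod>i\<leftarrow>L. sg (parity_fn (g i) (inst x))))
      = C L * ((\<Sum>S\<in>Pow {..<n}. \<Prod>q\<in>T L. sg (q \<in> S)) / 2 ^ n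
              - (\<Sum>b\<in>Pow {..<r}. \<Prod>q\<in>T L. sg (q \<in> gen b)) / 2 ^ r)"
      unfolding sumX by (simp add: inst_def CT(2)[OF L] sum_distrib_left[symmetric] algebra_simps)
    also have "\<dots> = 0"
    proof (cases "T L = {}")
      case True
      then show ?thesis by (simp add: card_Pow)
    next
      case False
      then have "T L \<in> \<T>" using L by (simp add: \<T>_def)
      moreover have "(\<Sum>S\<in>Pow {..<n}. \<Prod>q\<in>T L. sg (q \<in> S)) = 0"
        using False CT(1)[OF L] by (intro sum_character_eq_0) auto
      ultimately show ?thesis using gen_char by simp
    qed
    finally show "(\<Sum>x\<in>X. \<mu> x * (\<Prod>i\<leftarrow>L. sg (parity_fn (g i) (inst x)))) = 0" .
  qed
  then obtain p where p: "\<And>x. x \<in> X \<Longrightarrow> p x \<le> 1"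
      "\<And>x. x \<in> X \<Longrightarrow> feval (\<lambda>i. parity_fn (g i) (inst x)) F \<Longrightarrow> p x \<ge> 3/4"
      "\<And>x. x \<in> X \<Longrightarrow> \<not> feval (\<lambda>i. parity_fn (g i) (inst x)) F \<Longrightarrow> p x \<le> 1/4"
      "(\<Sum>x\<in>X. \<mu> x * p x) = 0" by (auto simp: abs_le_iff)
  have "(\<Sum>b\<in>Pow {..<r}. 3/4) \<le> (\<Sum>b\<in>Pow {..<r}. p (Inr b))"
    using easy by (intro sum_mono p(2)) (auto simp: X_def inst_def feval_iff)
  then have lo: "(\<Sum>b\<in>Pow {..<r}. p (Inr b)) / 2 ^ r \<ge> 3/4" by (simp add: card_Pow field_simps)
  define E where "E = {S \<in> Pow {..<n}. circuit_size_le m (map (\<lambda>i. i \<in> S) [0..<n]) l}"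
  have "card E \<le> (3 * (m + l)\<^sup>2 + 1) ^ l * (m + l)"
    unfolding E_def n_def using m by (intro card_circuit_size_le) simp
  then have "4 * card E \<le> 2 ^ n" using lower by (simp add: n_def)
  from of_nat_mono[OF this, where 'a = real] have E: "4 * real (card E) \<le> 2 ^ n" by simp
  \<comment> \<open>On hard tables \<open>p\<close> is at most 1/4. The easy ones, at most a quarter
    of all, add at most 1/4 to the average, which so stays at most 1/2, against at least 3/4 over
    the seeds.\<close>
  have "(\<Sum>S\<in>Pow {..<n}. p (Inl S)) \<le> (\<Sum>S\<in>Pow {..<n}. 1/4 + (if S \<in> E then 1 else 0))"
  proof (rule sum_mono)
    fix S assume S: "S \<in> Pow {..<n}"
    then have "Inl S \<in> X" by (auto simp: X_def)
    then show "p (Inl S) \<le> 1/4 + (if S \<in> E then 1 else 0)"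
      using p(1,3)[of "Inl S"] S by (fastforce simp: E_def inst_def feval_iff)
  qed
  also have "\<dots> = 2 ^ n / 4 + real (card E)"
  proof -
    have "Pow {..<n} \<inter> {S. S \<in> E} = E" by (auto simp: E_def)
    then show ?thesis by (simp add: sum.distrib sum.If_cases card_Pow)
  qed
  finally have "(\<Sum>S\<in>Pow {..<n}. p (Inl S)) / 2 ^ n \<le> 1/2" using E by (simp add: field_simps)
  then show False using lo p(4) unfolding sumX by linarith
qed

section \<open>Choice of parameters\<close>

lemma circuit_count_bound:
  fixes m l :: nat
  assumes "m \<ge> 4" "8 * (m + 1) * l \<le> 2 ^ m"
  shows "4 * ((3 * (m + l)\<^sup>2 + 1) ^ l * (m + l)) \<le> 2 ^ 2 ^ m"
proof -
  have m: "m + 3 \<le> 2 ^ (m - 1)" using assms(1)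
    by (induction m rule: dec_induct) (auto simp: Suc_diff_le power_eq_if)
  have half: "(2::nat) ^ m = 2 * 2 ^ (m - 1)" using assms(1) by (simp add: power_eq_if)
  have "8 * l \<le> 8 * (m + 1) * l" by simp
  then have l: "8 * l \<le> 2 ^ m" using assms(2) by linarith
  have q: "m + l \<le> 2 ^ m" using m half l by linarith
  \<comment> \<open>Each gate thus costs at most 2(m+1) bits, so \<open>l\<close> gates cost at most
    a quarter of 2^m. The output wire costs \<open>m\<close> bits and the factor 4 costs 2.\<close>
  have "3 * (m + l)\<^sup>2 + 1 \<le> 4 * (2 ^ m)\<^sup>2"
  proof -
    have "(1::nat) \<le> (2 ^ m)\<^sup>2" by simp
    then show ?thesis using power_mono[OF q, of 2] by linarith
  qed
  also have "\<dots> = 2 ^ (2 * (m + 1))" by (simp add: power_mult[symmetric] mult.commute)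
  finally have "(3 * (m + l)\<^sup>2 + 1) ^ l \<le> (2 ^ (2 * (m + 1))) ^ l" by (intro power_mono) auto
  then have "4 * ((3 * (m + l)\<^sup>2 + 1) ^ l * (m + l)) \<le> 2 ^ 2 * ((2 ^ (2 * (m + 1))) ^ l * 2 ^ m)"
    using q by (intro mult_mono) auto
  also have "\<dots> = 2 ^ (2 + (2 * (m + 1) * l + m))" by (simp only: power_mult[symmetric] power_add)
  also have "\<dots> \<le> 2 ^ 2 ^ m"
  proof (rule power_increasing)
    have "4 * (2 * (m + 1) * l) \<le> 2 ^ m" using assms(2) by (simp add: algebra_simps)
    then show "2 + (2 * (m + 1) * l + m) \<le> 2 ^ m" using m half by linarith
  qed simp
  finally show ?thesis .
qed

theorem theorem4p10:
  shows "\<exists>(c::real) > 0. \<exists>k::nat. \<exists>m0::nat. \<forall>m \<ge> m0. \<forall>s::nat.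
           in_formula_xor (2 * 2 ^ m) s (mcsp m) \<longrightarrow>
           real s \<ge> c * real (2 * 2 ^ m) ^ 2 / (log 2 (real (2 * 2 ^ m))) ^ k"
proof (rule exI[of _ "1 / 200000\<^sup>2"], rule conjI, simp,
    rule exI[of _ 10], rule exI[of _ 4], intro allI impI)
  fix m s :: nat
  assume m: "4 \<le> m" and formula: "in_formula_xor (2 * 2 ^ m) s (mcsp m)"
  \<comment> \<open>\<open>M\<close> is the logarithm of the input length. Generated tables have
    circuits of size O(M^4 \<open>\<tau>\<close>), to be compared with 2^m / (8M); hence
    \<open>\<tau>\<close>, and with it sqrt s, is at least of order 2^m / M^5. Squaring gives the
    exponent 10.\<close>
  define M where "M = m + 1"
  have log: "log 2 (real (2 * 2 ^ m)) = real M"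
  proof -
    have "real (2 * 2 ^ m) = 2 powr real M" by (simp add: M_def powr_realpow powr_add)
    then show ?thesis by simp
  qed
  have s: "real s \<ge> 1"
  proof -
    obtain F :: "nat dmformula" where "fsize F \<le> s" using formula unfolding in_formula_xor_def by blast
    then show ?thesis using fsize_pos[of F] by linarith
  qed
  show "1 / 200000\<^sup>2 * real (2 * 2 ^ m) ^ 2 / (log 2 (real (2 * 2 ^ m))) ^ 10 \<le> real s"
  proof (rule ccontr)
    assume "\<not> ?thesis"
    moreover have "1 / 200000\<^sup>2 * real (2 * 2 ^ m) ^ 2 / real M ^ 10 = (2 ^ M / (200000 * real M ^ 5))\<^sup>2"
      by (simp add: M_def power_divide power_mult_distrib power_mult[symmetric])
    ultimately have s_less: "real s < (2 ^ M / (200000 * real M ^ 5))\<^sup>2" by (simp only: log not_le)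
    have "sqrt (real s) < 2 ^ M / (200000 * real M ^ 5)"
      using s_less by (intro real_less_lsqrt) auto
    then have sqrt_s: "200000 * (real M ^ 5 * sqrt (real s)) < 2 * 2 ^ m"
      by (simp add: M_def field_simps)
    \<comment> \<open>As s >= 1, 1 + 16s <= 25s, whence 4 * 5 = 20; rounding up costs at most one
      further sqrt s.\<close>
    define \<tau> where "\<tau> = nat \<lceil>20 * sqrt (real s)\<rceil>"
    have sq1: "sqrt (real s) \<ge> 1" using s by simp
    have \<tau>: "20 * sqrt (real s) \<le> real \<tau>" "real \<tau> \<le> 21 * sqrt (real s)"
      unfolding \<tau>_def using sq1 by linarith+
    \<comment> \<open>(7/8)^6 is below 1/2, and s + 1 <= 2^(2M) by the assumed smallness of
      \<open>s\<close>, so this \<open>R\<close> makes the expected number of unhit characters at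
      most 1/2.\<close>
    define R where "R = 6 * (2 * M * \<tau> + 1)"
    define l where "l = 2 ^ m div (8 * M)"
    have "\<tau> \<ge> 1" using \<tau>(1) sq1 by linarith
    then have M\<tau>: "M * \<tau> \<ge> 1" by (simp add: M_def)
    show False
    proof (rule mcsp_formula_contradiction[OF formula])
      show "m > 0" using m by simp
      show "l \<le> 2 ^ m" by (simp add: l_def)
      have "sqrt (1 + 16 * real s) \<le> sqrt (25 * real s)" using s by simp
      also have "\<dots> = 5 * sqrt (real s)" by (simp add: real_sqrt_mult)
      finally show "4 * sqrt (1 + 16 * real s) \<le> real \<tau>" using \<tau>(1) by linarith
      have "real M ^ 5 \<ge> 1" by (intro one_le_power) (simp add: M_def)
      then have "(200000 * real M ^ 5)\<^sup>2 \<ge> 1" by (intro one_le_power) linarith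
      then have "(2 ^ M / (200000 * real M ^ 5))\<^sup>2 \<le> (2 ^ M)\<^sup>2"
        by (simp add: power_divide divide_le_eq)
      also have "\<dots> = real (2 ^ (2 * M))" by (simp add: power_mult[symmetric] mult.commute)
      finally have "real s < real (2 ^ (2 * M))" using s_less by (rule less_le_trans[rotated])
      then have "s + 1 \<le> 2 ^ (2 * M)" by (simp only: of_nat_less_iff)
      from of_nat_mono[OF this, where 'a = real] have "real s + 1 \<le> 2 ^ (2 * M)" by (simp add: add.commute)
      then have "(real s + 1) ^ \<tau> \<le> (2 ^ (2 * M)) ^ \<tau>" by (intro power_mono) auto
      moreover have "((7/8::real) ^ 6) ^ (2 * M * \<tau> + 1) \<le> (1/2) ^ (2 * M * \<tau> + 1)"
        by (intro power_mono) (simp_all add: power_divide)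
      ultimately have "(7/8) ^ R * (real s + 1) ^ \<tau> \<le> (1/2) ^ (2 * M * \<tau> + 1) * (2 ^ (2 * M)) ^ \<tau>"
        unfolding R_def power_mult by (intro mult_mono) auto
      also have "\<dots> = 1/2" by (simp add: power_mult[symmetric] power_divide)
      finally show "(7/8) ^ R * (real s + 1) ^ \<tau> < 1" by simp
      \<comment> \<open>4344 = 8 * 543, where 543 leaves room for the additive 2 beside the 540
        obtained below. Since 4344 * 21 = 91224 is less than 100000, the assumed bound on sqrt s
        suffices.\<close>
      have "real (4344 * (M ^ 5 * \<tau>)) \<le> 4344 * (real M ^ 5 * (21 * sqrt (real s)))"
        using mult_left_mono[OF \<tau>(2), of "real M ^ 5"] by (simp add: mult_ac)
      also have "\<dots> \<le> real (2 ^ m)"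
      proof -
        have "real M ^ 5 * sqrt (real s) \<ge> 0" by simp
        then show ?thesis using sqrt_s by (simp only: of_nat_power of_nat_numeral)
      qed
      finally have "8 * M * (543 * (M ^ 4 * \<tau>)) \<le> 2 ^ m"
        unfolding of_nat_le_iff by (simp add: power_eq_if algebra_simps)
      then have l: "543 * (M ^ 4 * \<tau>) \<le> l"
        unfolding l_def by (subst less_eq_div_iff_mult_less_eq) (auto simp: M_def mult_ac)
      have "(m + 2) * R * (3 + (m + 1) * (4 * m + 8) + 4) \<le> (2 * M) * (18 * (M * \<tau>)) * (15 * M\<^sup>2)"
      proof (intro mult_mono)
        show "R \<le> 18 * (M * \<tau>)" using M\<tau> by (simp add: R_def)
        show "3 + (m + 1) * (4 * m + 8) + 4 \<le> 15 * M\<^sup>2"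
          by (simp add: M_def power2_eq_square algebra_simps)
      qed (auto simp: M_def)
      also have "\<dots> = 540 * (M ^ 4 * \<tau>)" by (simp add: power_eq_if)
      finally have "2 + (m + 2) * R * (3 + (m + 1) * (4 * m + 8) + 4) \<le> 2 + 540 * (M ^ 4 * \<tau>)" by simp
      moreover have "M ^ 4 * \<tau> \<ge> 1" using \<open>\<tau> \<ge> 1\<close> by (simp add: M_def)
      ultimately show "2 + (m + 2) * R * (3 + (m + 1) * (4 * m + 8) + 4) \<le> l" using l by linarith
      have "8 * (m + 1) * l \<le> 2 ^ m" by (simp add: l_def M_def)
      then show "4 * ((3 * (m + l)\<^sup>2 + 1) ^ l * (m + l)) \<le> 2 ^ 2 ^ m"
        using m by (intro circuit_count_bound)
    qed
  qed
qed

end
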